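(* Let $\rho,\beta>0$. Suppose $f$ is differentiable, $l$-smooth and non-negative, and suppose $(W,\tilde W)$ is an admissible pair of mixing matrices for $(\mathcal G,\rho)$ (as defined in the context). Let $A$ be a real matrix with $A^TA=(\tilde W-W)\otimes I_p$. Let $L=l+\rho\|I_n-\tilde W\|$ and let $a$ be a constant with $1<a\le \frac{\rho^2(1-\lambda_2(W))}{4l(1+2\rho)}$. Suppose that $$\rho>1+\lambda_{\max}(\tilde W-W),\qquad \rho>\frac{8l+\sqrt{64l^2+16l(1-\lambda_2(W))}}{2(1-\lambda_2(W))},$$ $$\beta>(\rho+1)\lambda_{\max}(\tilde W-W)+1,\qquad \beta>\frac{\frac L2+\frac{1+2\rho}{\rho^2(1-\lambda_2(W))}\left(4l^2+4\rho^2\|I_n-\tilde W-(\tilde W-W)\|^2\right)}{1-1/a}.$$ Let $\mathbf x^r=(\mathbf x_1^r,\dots,\mathbf x_n^r)$ be the iterates generated by TT-EXTRA from an arbitrary $\mathbf x^0\in\mathbb R^{np}$, with the associated dual iterates $\lambda^r$ (both defined in the context). Then: (Convergence) $\mathbf x^r$ converges to the set $\mathcal X^*$ of first-order consensual stationary points, in the sense that asymptotically consensus and stationarity hold: $\lim_{r\to\infty}((I_n-W)\otimes I_p)\mathbf x^r=0$ and $\lim_{r\to\infty}(\mathbf 1^T\otimes I_p)\nabla f(\mathbf x^r)=0$. (Sub-linear rate) With $$T_\epsilon=\min\left\{r:\ \|\nabla f(\mathbf x^r)+A^T\lambda^r+((I_n-\tilde W)\otimes I_p)\mathbf x^r\|^2+\|A\mathbf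 x^r\|^2\le\epsilon\right\},$$ one has $T_\epsilon=\mathcal O(\epsilon^{-1})$.
   Context: Problem. $n\ge2$ agents are nodes of a connected undirected graph $\mathcal G=(\mathcal V,\mathcal E)$, $\mathcal V=\{1,\dots,n\}$. Each $f_i:\mathbb R^p\to\mathbb R$ is differentiable (possibly non-convex), and $f:\mathbb R^{np}\to\mathbb R$ is $f(\mathbf x)=\sum_{i=1}^n f_i(\mathbf x_i)$ for $\mathbf x=(\mathbf x_1^T,\dots,\mathbf x_n^T)^T$. "$l$-smooth" ($l>0$) means $\|\nabla f(\mathbf x)-\nabla f(\mathbf y)\|\le l\|\mathbf x-\mathbf y\|$ for all $\mathbf x,\mathbf y$; "non-negative" means $f(\mathbf x)\ge 0$ for all $\mathbf x$. Admissible mixing matrices. $(W,\tilde W)$, with $W,\tilde W\in\mathbb R^{n\times n}$, is admissible for $(\mathcal G,\rho)$ if: (i) $W_{ij}=\tilde W_{ij}=0$ whenever $i\ne j$ and $(i,j)\notin\mathcal E$; (ii) $W=W^T$, $\tilde W=\tilde W^T$; (iii) $\mathrm{null}\{W-\tilde W\}=\mathrm{span}\{\mathbf 1\}$ and $\mathrm{null}\{I_n-\tilde W\}\supseteq\mathrm{span}\{\mathbf 1\}$; (iv) $\frac{I_n+W}{2}\succeq\tilde W\succeq\frac{I_n+(\frac1\rho+1)W}{\frac1\rho+2}$ (Loewner order). TT-EXTRA (step-size parameters $\beta,\rho>0$). Given $\mathbf x_i^0\in\mathbb R^p$, set $\mathbf y_i^0=\rho\sum_{j}(\tilde W_{ij}-W_{ij})\mathbf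 x_j^0$ and for $r=0,1,2,\dots$ and all $i$: $$\mathbf x_i^{r+1}=\left(1-\tfrac\rho\beta\right)\mathbf x_i^r-\tfrac1\beta\nabla f_i(\mathbf x_i^r)+\tfrac\rho\beta\sum_j\tilde W_{ij}\mathbf x_j^r-\tfrac1\beta\mathbf y_i^r,\qquad \mathbf y_i^{r+1}=\mathbf y_i^r+\rho\sum_j(\tilde W_{ij}-W_{ij})\mathbf x_j^{r+1}.$$ Equivalently, with $A^TA=(\tilde W-W)\otimes I_p$, $\lambda^0=\rho A\mathbf x^0$ and $\mathbf y^r=A^T\lambda^r$: $$\mathbf x^{r+1}=\mathbf x^r-\tfrac1\beta\left(\nabla f(\mathbf x^r)+A^T\lambda^r+\rho((I_n-\tilde W)\otimes I_p)\mathbf x^r\right),\qquad \lambda^{r+1}=\lambda^r+\rho A\mathbf x^{r+1}.$$ First-order consensual stationary point: $\mathbf x^*\in\mathbb R^{np}$ with $((I_n-W)\otimes I_p)\mathbf x^*=0$ and $(\mathbf 1^T\otimes I_p)\nabla f(\mathbf x^* )=0$ (i.e. $\sum_i\nabla f_i(\mathbf x_i^* )=0$); $\mathcal X^*$ is the set of all of them. Notation: $\|\cdot\|$ is the Euclidean norm for vectors and the spectral norm for matrices; $\lambda_{\max}$ is the largest eigenvalue, $\lambda_2(W)$ the second largest eigenvalue of $W$ (with multiplicity); $\mathbf 1$ is the all-ones vector; $\otimes$ is the Kronecker product. *)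

theory Defs
  imports
    "HOL-Analysis.Analysis"
    "HOL-Computational_Algebra.Polynomial"
    "HOL-Library.Multiset"
    "HOL-Library.Landau_Symbols"
begin

text \<open>
  The number of agents is \<open>n = CARD('n)\<close> and the local dimension is \<open>p = CARD('p)\<close>.  A stacked vector
  is an element of \<open>real ^ ('n \<times> 'p)\<close>, whose \<open>i\<close>-th block consists of the coordinates \<open>(i, k)\<close>; this is
  the indexing under which \<open>M \<otimes> I\<^sub>p\<close> acts blockwise.
\<close>

subsection \<open>Matrices\<close>

definition kron :: "real ^ 'b::finite ^ 'a::finite \<Rightarrow> real ^ 'd::finite ^ 'c::finite \<Rightarrow> real ^ ('b \<times> 'd) ^ ('a \<times> 'c)" where
  "kron M N = (\<chi> r c. M $ fst r $ fst c * N $ snd r $ snd c)"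

definition block :: "real ^ ('n::finite \<times> 'p::finite) \<Rightarrow> 'n \<Rightarrow> real ^ 'p" where
  "block x i = (\<chi> k. x $ (i, k))"

definition psd :: "real ^ 'n::finite ^ 'n \<Rightarrow> bool" where
  "psd M \<longleftrightarrow> transpose M = M \<and> (\<forall>v. 0 \<le> v \<bullet> (M *v v))"

definition loewner_le :: "real ^ 'n::finite ^ 'n \<Rightarrow> real ^ 'n ^ 'n \<Rightarrow> bool"  (infix \<open>\<preceq>\<^sub>L\<close> 50) where
  "M \<preceq>\<^sub>L N \<longleftrightarrow> psd (N - M)"

definition null_space :: "real ^ 'n::finite ^ 'm::finite \<Rightarrow> (real ^ 'n) set" where
  "null_space M = {v. M *v v = 0}"

definition spectral_norm :: "real ^ 'n::finite ^ 'm::finite \<Rightarrow> real" where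
  "spectral_norm M = onorm ((*v) M)"

definition charpoly :: "real ^ 'n::finite ^ 'n \<Rightarrow> real poly" where
  "charpoly M = det (\<chi> i j. (if i = j then [:0, 1:] else 0) - [:M $ i $ j:])"

text \<open>
  Real eigenvalues in descending order, repeated according to (algebraic) multiplicity.  Used for
  symmetric matrices only, where the list has length \<open>CARD('n)\<close>.
\<close>
definition eigvals :: "real ^ 'n::finite ^ 'n \<Rightarrow> real list" where
  "eigvals M = rev (sorted_list_of_multiset (proots (charpoly M)))"

definition lambda_max :: "real ^ 'n::finite ^ 'n \<Rightarrow> real" where
  "lambda_max M = eigvals M ! 0"

definition lambda_2 :: "real ^ 'n::finite ^ 'n \<Rightarrow> real" where
  "lambda_2 M = eigvals M ! 1"

subsection \<open>Graph and mixing matrices\<close>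

text \<open>The vertex set is all of \<open>'n\<close>.  Loops play no role: \<open>admissible\<close> ignores the diagonal.\<close>
definition connected_undirected :: "('n::finite \<times> 'n) set \<Rightarrow> bool" where
  "connected_undirected E \<longleftrightarrow> sym E \<and> (\<forall>i j. (i, j) \<in> E\<^sup>*)"

text \<open>In \<open>admissible\<close>, the vector \<open>1 :: real ^ 'n\<close> is the all-ones vector.\<close>
definition admissible ::
  "('n::finite \<times> 'n) set \<Rightarrow> real \<Rightarrow> real ^ 'n ^ 'n \<Rightarrow> real ^ 'n ^ 'n \<Rightarrow> bool" where
  "admissible E \<rho> W Wt \<longleftrightarrow>
     (\<forall>i j. i \<noteq> j \<and> (i, j) \<notin> E \<longrightarrow> W $ i $ j = 0 \<and> Wt $ i $ j = 0) \<and>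
     W = transpose W \<and> Wt = transpose Wt \<and>
     null_space (W - Wt) = span {1} \<and>
     span {1} \<subseteq> null_space (mat 1 - Wt) \<and>
     Wt \<preceq>\<^sub>L (1 / 2) *\<^sub>R (mat 1 + W) \<and>
     (1 / (1 / \<rho> + 2)) *\<^sub>R (mat 1 + (1 / \<rho> + 1) *\<^sub>R W) \<preceq>\<^sub>L Wt"

subsection \<open>Objective\<close>

definition grad :: "('a::real_inner \<Rightarrow> real) \<Rightarrow> 'a \<Rightarrow> 'a" where
  "grad g x = (THE D. GDERIV g x :> D)"

definition total_cost :: "('n::finite \<Rightarrow> real ^ 'p::finite \<Rightarrow> real) \<Rightarrow> real ^ ('n \<times> 'p) \<Rightarrow> real" where
  "total_cost f x = (\<Sum>i\<in>UNIV. f i (block x i))"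

definition smooth :: "real \<Rightarrow> ('a::real_inner \<Rightarrow> real) \<Rightarrow> bool" where
  "smooth l g \<longleftrightarrow> l > 0 \<and> (\<forall>x y. norm (grad g x - grad g y) \<le> l * norm (x - y))"

subsection \<open>TT-EXTRA\<close>

definition tt_extra ::
  "('n::finite \<Rightarrow> real ^ 'p::finite \<Rightarrow> real) \<Rightarrow> real ^ 'n ^ 'n \<Rightarrow> real ^ 'n ^ 'n \<Rightarrow> real \<Rightarrow> real \<Rightarrow>
   (nat \<Rightarrow> real ^ ('n \<times> 'p)) \<Rightarrow> (nat \<Rightarrow> real ^ ('n \<times> 'p)) \<Rightarrow> bool" where
  "tt_extra f W Wt \<rho> \<beta> x y \<longleftrightarrow>
     (\<forall>i. block (y 0) i = \<rho> *\<^sub>R (\<Sum>j\<in>UNIV. (Wt $ i $ j - W $ i $ j) *\<^sub>R block (x 0) j)) \<and>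
     (\<forall>r i. block (x (Suc r)) i =
        (1 - \<rho> / \<beta>) *\<^sub>R block (x r) i
        - (1 / \<beta>) *\<^sub>R grad (f i) (block (x r) i)
        + (\<rho> / \<beta>) *\<^sub>R (\<Sum>j\<in>UNIV. Wt $ i $ j *\<^sub>R block (x r) j)
        - (1 / \<beta>) *\<^sub>R block (y r) i) \<and>
     (\<forall>r i. block (y (Suc r)) i =
        block (y r) i + \<rho> *\<^sub>R (\<Sum>j\<in>UNIV. (Wt $ i $ j - W $ i $ j) *\<^sub>R block (x (Suc r)) j))"

definition dual_iterates ::
  "real ^ ('n::finite \<times> 'p::finite) ^ 'm::finite \<Rightarrow> real \<Rightarrow> (nat \<Rightarrow> real ^ ('n \<times> 'p)) \<Rightarrow> (nat \<Rightarrow> real ^ 'm) \<Rightarrow> bool" where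
  "dual_iterates A \<rho> x lam \<longleftrightarrow>
     lam 0 = \<rho> *\<^sub>R (A *v x 0) \<and>
     (\<forall>r. lam (Suc r) = lam r + \<rho> *\<^sub>R (A *v x (Suc r)))"

text \<open>There is no factor \<open>\<rho>\<close> in front of \<open>(I - Wt) \<otimes> I\<close> here, unlike in the primal update.\<close>
definition optimality_gap ::
  "('n::finite \<Rightarrow> real ^ 'p::finite \<Rightarrow> real) \<Rightarrow> real ^ 'n ^ 'n \<Rightarrow> real ^ ('n \<times> 'p) ^ 'm::finite \<Rightarrow>
   real ^ ('n \<times> 'p) \<Rightarrow> real ^ 'm \<Rightarrow> real" where
  "optimality_gap f Wt A x lam =
     (norm (grad (total_cost f) x + transpose A *v lam + kron (mat 1 - Wt) (mat 1) *v x))\<^sup>2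
     + (norm (A *v x))\<^sup>2"

text \<open>
  Only meaningful if the gap reaches \<open>\<epsilon>\<close> at some index; \<open>LEAST\<close> is unspecified otherwise.
\<close>
definition hitting_time :: "(nat \<Rightarrow> real) \<Rightarrow> real \<Rightarrow> nat" where
  "hitting_time gap \<epsilon> = (LEAST r. gap r \<le> \<epsilon>)"

end

theory Submission
  imports Defs
begin

text \<open>
  Write \<open>B = I - Wt\<close> and \<open>S = Wt - W\<close>, so that \<open>A\<^sup>T A\<close> is \<open>S\<close> acting on each coordinate.  TT-EXTRA is a
  linearized primal-dual method: a gradient step with step size \<open>1 / \<beta>\<close> on the augmented Lagrangian
  \<open>f x + lam \<bullet> A x + \<rho> / 2 * (x \<bullet> B x)\<close>, then an ascent step in \<open>lam\<close>.  The proof finds a Lyapunov function.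

  The primal step lowers the Lagrangian by a multiple of \<open>\<parallel>w\<parallel>\<^sup>2\<close>, where \<open>w\<close> is the increment of \<open>x\<close>; the dual
  step raises it by \<open>\<rho> \<parallel>A x\<parallel>\<^sup>2\<close>.  Subtracting two consecutive primal steps shows that \<open>A\<^sup>T\<close> applied to the dual
  increment equals, up to sign, a gradient difference, plus \<open>\<rho> (B - S) w\<close>, plus \<open>(\<beta> - \<rho> B) v\<close>, where \<open>v\<close> is the
  difference of the two last increments.  By the spectral gap of \<open>S\<close>, which is \<open>1 / \<kappa> = \<rho> (1 - lambda_2 W) / (1 + 2 \<rho>)\<close>
  at least, the rise is bounded by squared increments and by the energy of \<open>v\<close> under \<open>\<beta> - \<rho> B\<close>
  (\<open>dual_increment_bound\<close>).  Pairing the same identity with \<open>w\<close> yields a second energy that decreases by the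
  energy of \<open>v\<close> up to \<open>l \<parallel>w\<parallel>\<^sup>2\<close> (\<open>residual_energy_step\<close>).  Adding it with weight \<open>4 \<kappa> \<beta> / \<rho>\<close> cancels \<open>v\<close>
  altogether, and the remaining coefficient of \<open>\<parallel>w\<parallel>\<^sup>2\<close> is negative: the upper bound on \<open>a\<close> keeps the cost of
  this weight below \<open>\<beta> / a\<close>, and the last lower bound on \<open>\<beta>\<close> pays for the rest (\<open>potential_step\<close>).

  The resulting potential is nonincreasing, and it is nonnegative because the sums of the multiplier term
  \<open>lam \<bullet> A x\<close> telescope up to nonnegative squares (\<open>potential_nonneg\<close>).  Hence \<open>\<parallel>w\<parallel>\<^sup>2\<close> and then \<open>\<parallel>A x\<parallel>\<^sup>2\<close> are
  summable.  The optimality gap is at most a constant times \<open>\<parallel>w\<parallel>\<^sup>2 + \<parallel>A x\<parallel>\<^sup>2\<close>, so it is summable too, which gives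
  the hitting time of order \<open>1 / \<epsilon>\<close>.  Consensus follows as \<open>I - W\<close> is dominated by \<open>S\<close>, and stationarity by
  summing the primal step over the agents, which leaves only the gradients and \<open>\<beta> w\<close>.

  On the matrix side, the two Loewner bounds read \<open>S \<le> B \<le> (1 + \<rho>) / \<rho> S\<close>.  They give the spectral gap, the
  domination of \<open>I - W\<close> by \<open>S\<close>, and, with the lower bound on \<open>\<beta>\<close> by \<open>lambda_max\<close>, the positivity of \<open>\<beta> - \<rho> B\<close>.
\<close>

section \<open>Eigenvalues of symmetric matrices\<close>

text \<open>
  Evaluating the nonnegative form at \<open>z - T z / b\<close>, the point to which a gradient step of length
  \<open>1 / b\<close> on half the form leads, gives the bound.  It replaces the square root of \<open>T\<close>.  The subspace \<open>V\<close>
  allows forms that are nonnegative only on a hyperplane.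
\<close>
lemma psd_norm_le:
  fixes T :: "'a::real_inner \<Rightarrow> 'a"
  assumes V: "subspace V" and lin: "linear T" and inv: "\<And>z. z \<in> V \<Longrightarrow> T z \<in> V"
    and sym: "\<And>x y. T x \<bullet> y = x \<bullet> T y"
    and pos: "\<And>z. z \<in> V \<Longrightarrow> 0 \<le> z \<bullet> T z"
    and b: "b > 0" "\<And>z. z \<in> V \<Longrightarrow> z \<bullet> T z \<le> b * (norm z)\<^sup>2"
    and z: "z \<in> V"
  shows "(norm (T z))\<^sup>2 \<le> b * (z \<bullet> T z)"
proof -
  define u where "u = z - (1 / b) *\<^sub>R T z"
  have "u \<in> V" unfolding u_def by (intro subspace_diff subspace_scale V z inv)
  have "z \<bullet> T (T z) = (norm (T z))\<^sup>2" by (simp add: sym[symmetric] power2_norm_eq_inner)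
  then have "u \<bullet> T u = z \<bullet> T z - 2 / b * (norm (T z))\<^sup>2 + (1 / b\<^sup>2) * (T z \<bullet> T (T z))"
    unfolding u_def linear_diff[OF lin] linear_scale[OF lin]
    using b(1) by (simp add: inner_diff_left inner_diff_right dot_square_norm field_simps power2_eq_square)
  with pos[OF \<open>u \<in> V\<close>]
  have "0 \<le> z \<bullet> T z - 2 / b * (norm (T z))\<^sup>2 + (1 / b\<^sup>2) * (T z \<bullet> T (T z))" by simp
  also have "\<dots> \<le> z \<bullet> T z - 2 / b * (norm (T z))\<^sup>2 + (1 / b\<^sup>2) * (b * (norm (T z))\<^sup>2)"
    by (intro add_left_mono mult_left_mono b(2) inv z) simp
  also have "\<dots> = z \<bullet> T z - (norm (T z))\<^sup>2 / b"
    using b(1) by (simp add: field_simps power2_eq_square)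
  finally show ?thesis using b(1) by (simp add: field_simps)
qed

lemma symmetric_matrix_inner:
  fixes M :: "real ^ 'n ^ 'n"
  assumes "transpose M = M"
  shows "(M *v x) \<bullet> y = x \<bullet> (M *v y)"
  by (metis assms dot_lmul_matrix inner_commute transpose_matrix_vector)

text \<open>
  The Rayleigh quotient attains its maximum \<open>\<mu>\<close> on the compact unit sphere of \<open>V\<close>, say at \<open>u\<close>.
  Then \<open>T = \<mu> - M\<close> is positive semidefinite on \<open>V\<close> and its form vanishes at \<open>u\<close>, so \<open>T u = 0\<close> by
  \<open>psd_norm_le\<close>.
\<close>
lemma symmetric_rayleigh_max_eigenvector:
  fixes M :: "real ^ 'n ^ 'n"
  assumes sym: "transpose M = M" and V: "subspace V" "V \<noteq> {0}"
    and inv: "\<And>z. z \<in> V \<Longrightarrow> M *v z \<in> V"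
  obtains \<mu> u where "u \<in> V" "u \<noteq> 0" "M *v u = \<mu> *\<^sub>R u"
    "\<And>z. z \<in> V \<Longrightarrow> z \<bullet> (M *v z) \<le> \<mu> * (norm z)\<^sup>2"
proof -
  let ?K = "sphere 0 1 \<inter> V"
  obtain v0 where v0: "v0 \<in> V" "v0 \<noteq> 0" using V subspace_0 by blast
  have "v0 /\<^sub>R norm v0 \<in> ?K" using v0 V by (simp add: subspace_scale)
  then have "?K \<noteq> {}" by blast
  moreover have "compact ?K" by (intro compact_Int_closed closed_subspace V) simp
  moreover have "continuous_on ?K (\<lambda>z. z \<bullet> (M *v z))"
    by (intro continuous_intros linear_continuous_on) simp
  ultimately have "\<exists>u\<in>?K. \<forall>z\<in>?K. z \<bullet> (M *v z) \<le> u \<bullet> (M *v u)"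
    by (intro continuous_attains_sup)
  then obtain u where u: "u \<in> ?K" and max: "\<And>z. z \<in> ?K \<Longrightarrow> z \<bullet> (M *v z) \<le> u \<bullet> (M *v u)"
    by blast
  define \<mu> where "\<mu> = u \<bullet> (M *v u)"
  define T where "T z = \<mu> *\<^sub>R z - M *v z" for z
  have le: "z \<bullet> (M *v z) \<le> \<mu> * (norm z)\<^sup>2" if "z \<in> V" for z
  proof (cases "z = 0")
    case False
    then have "z /\<^sub>R norm z \<in> ?K" using that V by (simp add: subspace_scale)
    from max[OF this] show ?thesis
      using False by (simp add: \<mu>_def matrix_vector_mult_scaleR field_simps power2_eq_square)
  qed simp
  have lin: "linear T"
    unfolding T_def by (rule linearI) (simp_all add: matrix_vector_right_distrib matrix_vector_mult_scaleR algebra_simps)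
  have Tu: "u \<bullet> T u = 0"
    using u by (simp add: T_def \<mu>_def inner_diff_right dot_square_norm)
  obtain b where b: "b > 0" "\<And>z. norm (T z) \<le> norm z * b"
    using bounded_linear.pos_bounded[OF lin[unfolded linear_conv_bounded_linear]] by blast
  have "(norm (T u))\<^sup>2 \<le> b * (u \<bullet> T u)"
  proof (rule psd_norm_le[OF V(1) lin])
    show "T z \<in> V" if "z \<in> V" for z
      unfolding T_def by (intro subspace_diff subspace_scale V inv that)
    show "T x \<bullet> y = x \<bullet> T y" for x y
      by (simp add: T_def inner_diff_left inner_diff_right symmetric_matrix_inner[OF sym])
    show "0 \<le> z \<bullet> T z" if "z \<in> V" for z
      using le[OF that] by (simp add: T_def inner_diff_right dot_square_norm)
    show "z \<bullet> T z \<le> b * (norm z)\<^sup>2" for z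
    proof -
      have "z \<bullet> T z \<le> norm z * norm (T z)" by (rule norm_cauchy_schwarz)
      also have "\<dots> \<le> norm z * (norm z * b)" by (intro mult_left_mono b) simp
      finally show ?thesis by (simp add: power2_eq_square mult.commute mult.left_commute)
    qed
  qed (use u b in auto)
  then have "T u = 0" by (simp add: Tu)
  then have "M *v u = \<mu> *\<^sub>R u" by (simp add: T_def)
  moreover have "u \<noteq> 0" using u by auto
  ultimately show ?thesis using that u le by blast
qed

lemma poly_charpoly: "poly (charpoly M) t = det (t *\<^sub>R mat 1 - M)"
  unfolding charpoly_def det_def
  by (simp add: poly_sum poly_prod mat_def)
    (intro sum.cong refl arg_cong2[where f="(*)"] prod.cong; simp)

lemma poly_charpoly_eq_0_iff:
  "poly (charpoly M) t = 0 \<longleftrightarrow> (\<exists>v. v \<noteq> 0 \<and> M *v v = t *\<^sub>R v)"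
proof -
  have *: "(t *\<^sub>R mat 1 - M) *v v = t *\<^sub>R v - M *v v" for v
    by (simp add: matrix_vector_mult_diff_rdistrib scaleR_matrix_vector_assoc[symmetric])
  have "poly (charpoly M) t = 0 \<longleftrightarrow> \<not> invertible (t *\<^sub>R mat 1 - M)"
    by (simp add: poly_charpoly invertible_det_nz)
  also have "\<dots> \<longleftrightarrow> (\<exists>v. v \<noteq> 0 \<and> (t *\<^sub>R mat 1 - M) *v v = 0)"
    unfolding invertible_left_inverse matrix_left_invertible_ker by blast
  finally show ?thesis unfolding * right_minus_eq by metis
qed

lemma charpoly_nonzero: "charpoly M \<noteq> 0"
proof -
  obtain b where b: "b > 0" "\<And>z. norm (M *v z) \<le> norm z * b"
    using bounded_linear.pos_bounded[OF matrix_vector_mul_bounded_linear[of M]] by blast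
  have "poly (charpoly M) (b + 1) \<noteq> 0"
  proof
    assume "poly (charpoly M) (b + 1) = 0"
    then obtain v where "v \<noteq> 0" "M *v v = (b + 1) *\<^sub>R v" using poly_charpoly_eq_0_iff by blast
    then show False using b(1) b(2)[of v] by (simp only: norm_scaleR) (simp add: algebra_simps)
  qed
  then show ?thesis by auto
qed

text \<open>
  The list \<open>eigvals\<close> counts algebraic multiplicities, but bounding its first two entries from below
  only takes the set of its members: two distinct eigenvalues occupy two distinct positions.
\<close>
lemma set_eigvals: "set (eigvals M) = {t. \<exists>v. v \<noteq> 0 \<and> M *v v = t *\<^sub>R v}"
  by (simp add: eigvals_def charpoly_nonzero poly_charpoly_eq_0_iff)

lemma eigvals_descending: "i \<le> j \<Longrightarrow> j < length (eigvals M) \<Longrightarrow> eigvals M ! j \<le> eigvals M ! i"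
  unfolding eigvals_def by (intro sorted_rev_nth_mono) auto

lemma eigenvalue_le_lambda_max:
  assumes "v \<noteq> 0" "M *v v = t *\<^sub>R v"
  shows "t \<le> lambda_max M"
proof -
  have "t \<in> set (eigvals M)" using assms by (auto simp: set_eigvals)
  then obtain i where "i < length (eigvals M)" "eigvals M ! i = t" by (auto simp: in_set_conv_nth)
  then show ?thesis unfolding lambda_max_def using eigvals_descending[of 0 i M] by simp
qed

lemma smaller_eigenvalue_le_lambda_2:
  assumes "v \<noteq> 0" "M *v v = t *\<^sub>R v" "w \<noteq> 0" "M *v w = s *\<^sub>R w" "t < s"
  shows "t \<le> lambda_2 M"
proof -
  have "t \<in> set (eigvals M)" "s \<in> set (eigvals M)" using assms by (auto simp: set_eigvals)
  then obtain i j where i: "i < length (eigvals M)" "eigvals M ! i = t"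
    and j: "j < length (eigvals M)" "eigvals M ! j = s" by (auto simp: in_set_conv_nth)
  have "\<not> i \<le> j" using eigvals_descending[of i j M] i j \<open>t < s\<close> by auto
  then have "1 \<le> i" by simp
  then show ?thesis unfolding lambda_2_def using eigvals_descending[of 1 i M] i by simp
qed

lemma rayleigh_le_lambda_max:
  fixes M :: "real ^ 'n ^ 'n"
  assumes sym: "transpose M = M"
  shows "z \<bullet> (M *v z) \<le> lambda_max M * (norm z)\<^sup>2"
proof -
  have "(UNIV :: (real ^ 'n) set) \<noteq> {0}"
    by (metis UNIV_I singletonD zero_neq_one)
  then obtain \<mu> u where "u \<noteq> 0" "M *v u = \<mu> *\<^sub>R u" "z \<bullet> (M *v z) \<le> \<mu> * (norm z)\<^sup>2"
    by (rule symmetric_rayleigh_max_eigenvector[OF sym subspace_UNIV]) auto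
  moreover from this have "\<mu> \<le> lambda_max M" by (intro eigenvalue_le_lambda_max)
  ultimately show ?thesis by (smt (verit) mult_right_mono zero_le_power2)
qed

text \<open>
  The Rayleigh maximum over \<open>e\<close>'s orthogonal complement is an eigenvalue of \<open>M\<close>, and by assumption it is
  smaller than \<open>s\<close>.  Since \<open>s\<close> is an eigenvalue as well, it cannot be the first entry of \<open>eigvals M\<close>.
\<close>
lemma rayleigh_le_lambda_2:
  fixes M :: "real ^ 'n ^ 'n"
  assumes sym: "transpose M = M" and e: "e \<noteq> 0" "M *v e = s *\<^sub>R e"
    and simple: "\<And>v. v \<noteq> 0 \<Longrightarrow> e \<bullet> v = 0 \<Longrightarrow> v \<bullet> (M *v v) < s * (norm v)\<^sup>2"
    and z: "e \<bullet> z = 0"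
  shows "z \<bullet> (M *v z) \<le> lambda_2 M * (norm z)\<^sup>2"
proof (cases "z = 0")
  case False
  let ?V = "{v. e \<bullet> v = 0}"
  have "?V \<noteq> {0}" using False z by blast
  moreover have "M *v v \<in> ?V" if "v \<in> ?V" for v
    using that e by (simp add: symmetric_matrix_inner[OF sym, symmetric])
  ultimately obtain \<mu> u where u: "u \<in> ?V" "u \<noteq> 0" "M *v u = \<mu> *\<^sub>R u"
    and le: "z \<bullet> (M *v z) \<le> \<mu> * (norm z)\<^sup>2"
    by (rule symmetric_rayleigh_max_eigenvector[OF sym subspace_hyperplane[of e]]) (auto simp: z)
  have "\<mu> * (norm u)\<^sup>2 < s * (norm u)\<^sup>2"
    using simple[of u] u by (simp add: dot_square_norm)
  then have "\<mu> < s" using u by simp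
  then have "\<mu> \<le> lambda_2 M" using u e by (intro smaller_eigenvalue_le_lambda_2[of u M \<mu> e s])
  then show ?thesis using le by (smt (verit) mult_right_mono zero_le_power2)
qed simp

section \<open>Gradients and the descent inequality\<close>

lemma GDERIV_unique:
  assumes "GDERIV g x :> D" "GDERIV g x :> D'"
  shows "D = D'"
proof -
  have "(\<lambda>h. h \<bullet> D) = (\<lambda>h. h \<bullet> D')"
    using assms unfolding gderiv_def by (rule has_derivative_unique)
  then have "(D - D') \<bullet> (D - D') = 0" by (metis inner_diff_right right_minus_eq)
  then show ?thesis by simp
qed

lemma grad_eqI: "GDERIV g x :> D \<Longrightarrow> grad g x = D"
  unfolding grad_def by (blast intro: GDERIV_unique)

lemma GDERIV_grad:
  fixes g :: "'a::euclidean_space \<Rightarrow> real"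
  assumes "g differentiable at x"
  shows "GDERIV g x :> grad g x"
proof -
  obtain g' where g': "(g has_derivative g') (at x)" using assms by (auto simp: differentiable_def)
  then interpret linear g' by (rule has_derivative_linear)
  have "g' = (\<lambda>h. h \<bullet> (\<Sum>b\<in>Basis. g' b *\<^sub>R b))"
  proof
    fix h
    have "g' h = g' (\<Sum>b\<in>Basis. (h \<bullet> b) *\<^sub>R b)" by (simp add: euclidean_representation)
    then show "g' h = h \<bullet> (\<Sum>b\<in>Basis. g' b *\<^sub>R b)"
      by (simp add: sum scale inner_sum_right mult.commute)
  qed
  then have "GDERIV g x :> (\<Sum>b\<in>Basis. g' b *\<^sub>R b)" using g' by (simp add: gderiv_def)
  then show ?thesis by (simp add: grad_eqI)
qed

text \<open>
  Along the segment from \<open>x\<close> to \<open>y\<close> the difference of the two sides has a derivative of one sign.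
\<close>
lemma lipschitz_gradient_upper_bound:
  assumes D: "\<And>x. GDERIV F x :> g x"
    and lip: "\<And>x y. norm (g x - g y) \<le> l * norm (x - y)"
  shows "F y \<le> F x + g x \<bullet> (y - x) + l / 2 * (norm (y - x))\<^sup>2"
proof -
  let ?d = "y - x"
  define h where "h t = F (x + t *\<^sub>R ?d) - t * (g x \<bullet> ?d) - l / 2 * t\<^sup>2 * (norm ?d)\<^sup>2" for t
  have F': "((\<lambda>t. F (x + t *\<^sub>R ?d)) has_real_derivative ?d \<bullet> g (x + t *\<^sub>R ?d)) (at t)" for t
  proof -
    have "((\<lambda>t. F (x + t *\<^sub>R ?d)) has_derivative (\<lambda>s. (s *\<^sub>R ?d) \<bullet> g (x + t *\<^sub>R ?d))) (at t)"
      by (rule has_derivative_compose[OF _ D[unfolded gderiv_def]]) (auto intro!: derivative_eq_intros)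
    then show ?thesis by (simp add: has_field_derivative_def mult_commute_abs)
  qed
  have "h 1 \<le> h 0"
  proof (rule DERIV_nonpos_imp_nonincreasing[of 0 1 h])
    fix t :: real assume t: "0 \<le> t" "t \<le> 1"
    have "(h has_real_derivative ?d \<bullet> g (x + t *\<^sub>R ?d) - g x \<bullet> ?d - l * t * (norm ?d)\<^sup>2) (at t)"
      unfolding h_def by (auto intro!: derivative_eq_intros F')
    moreover have "?d \<bullet> g (x + t *\<^sub>R ?d) - g x \<bullet> ?d \<le> l * t * (norm ?d)\<^sup>2"
    proof -
      have "?d \<bullet> g (x + t *\<^sub>R ?d) - g x \<bullet> ?d = ?d \<bullet> (g (x + t *\<^sub>R ?d) - g x)"
        by (simp add: inner_diff_right inner_commute)
      also have "\<dots> \<le> norm ?d * norm (g (x + t *\<^sub>R ?d) - g x)" by (rule norm_cauchy_schwarz)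
      also have "\<dots> \<le> norm ?d * (l * norm (t *\<^sub>R ?d))"
        using lip[of "x + t *\<^sub>R ?d" x] by (intro mult_left_mono) auto
      also have "\<dots> = l * t * (norm ?d)\<^sup>2"
        using t unfolding norm_scaleR by (simp add: power2_eq_square)
      finally show ?thesis .
    qed
    ultimately show "\<exists>z. DERIV h t :> z \<and> z \<le> 0" by force
  qed simp
  then show ?thesis by (simp add: h_def)
qed

section \<open>The linearized primal-dual iteration\<close>

text \<open>
  Gradient descent with step \<open>1 / \<beta>\<close> in the primal variable of the augmented Lagrangian
  \<open>F z + u \<bullet> A z + \<rho> / 2 * (z \<bullet> B z)\<close>, followed by dual ascent on the constraint \<open>A z = 0\<close>.  The penalty \<open>B\<close>
  need not be \<open>A\<^sup>T A\<close>; it only has to dominate it.  Three quadratic comparisons drive the analysis: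
  \<open>A\<^sup>T A \<le> B\<close>, \<open>\<rho> B \<le> \<beta>\<close>, and the spectral gap \<open>1 / \<kappa>\<close> of \<open>A\<^sup>T A\<close> on its range.

  In \<open>step_size\<close> the first summand is half the smoothness constant of the augmented Lagrangian, the second
  pays for the part of the dual step that is of the size of the primal increments, and the third pays for the
  Lipschitz error that enters with the factor \<open>weight\<close> below.
\<close>
locale linearized_primal_dual =
  fixes F :: "'a::real_inner \<Rightarrow> real" and g :: "'a \<Rightarrow> 'a"
    and A :: "'a \<Rightarrow> 'b::real_inner" and At :: "'b \<Rightarrow> 'a" and B :: "'a \<Rightarrow> 'a"
    and l b q \<kappa> \<rho> \<beta> :: real
    and x :: "nat \<Rightarrow> 'a" and lam :: "nat \<Rightarrow> 'b"
  assumes gradient: "\<And>z. GDERIV F z :> g z"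
    and lipschitz: "\<And>u v. norm (g u - g v) \<le> l * norm (u - v)"
    and nonneg: "\<And>z. 0 \<le> F z"
    and linear_A: "linear A" and linear_At: "linear At" and linear_B: "linear B"
    and adjoint_A: "\<And>z u. A z \<bullet> u = z \<bullet> At u"
    and symmetric_B: "\<And>u v. B u \<bullet> v = u \<bullet> B v"
    and dominates: "\<And>z. (norm (A z))\<^sup>2 \<le> z \<bullet> B z"
    and B_le: "\<And>z. z \<bullet> B z \<le> b * (norm z)\<^sup>2"
    and scaled_B_le: "\<And>z. \<rho> * (z \<bullet> B z) \<le> \<beta> * (norm z)\<^sup>2"
    and mismatch: "\<And>z. norm (B z - At (A z)) \<le> q * norm z"
    and spectral_gap: "\<And>z. (norm (A z))\<^sup>2 \<le> \<kappa> * (norm (At (A z)))\<^sup>2"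
    and \<kappa>_nonneg: "0 \<le> \<kappa>" and l_pos: "0 < l" and \<rho>_pos: "0 < \<rho>" and \<beta>_pos: "0 < \<beta>"
    and step_size: "(l + \<rho> * b) / 2 + \<kappa> / \<rho> * (4 * l\<^sup>2 + 4 * \<rho>\<^sup>2 * q\<^sup>2) + 4 * \<kappa> * \<beta> * l / \<rho> < \<beta>"
    and primal: "\<And>n. \<beta> *\<^sub>R (x (Suc n) - x n) = - (g (x n) + At (lam n) + \<rho> *\<^sub>R B (x n))"
    and dual: "\<And>n. lam (Suc n) = lam n + \<rho> *\<^sub>R A (x (Suc n))"
begin

definition increment :: "nat \<Rightarrow> 'a" where
  "increment n = x (Suc n) - x n"

definition lagrangian :: "'a \<Rightarrow> 'b \<Rightarrow> real" where
  "lagrangian z u = F z + u \<bullet> A z + \<rho> / 2 * (z \<bullet> B z)"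

text \<open>
  Subtracting consecutive primal steps expresses the dual increment through consecutive primal increments.
  Collecting \<open>\<rho> B\<close> with the newer increment leaves the operator \<open>\<beta> - \<rho> B\<close>, which acts on the
  difference of the increments and is positive semidefinite.
\<close>
definition prox :: "'a \<Rightarrow> 'a" where
  "prox z = \<beta> *\<^sub>R z - \<rho> *\<^sub>R B z"

definition mismatch_op :: "'a \<Rightarrow> 'a" where
  "mismatch_op z = B z - At (A z)"

lemma linear_prox: "linear prox"
  unfolding prox_def
  by (rule linearI) (simp_all add: linear_add[OF linear_B] linear_scale[OF linear_B] algebra_simps)

lemma symmetric_prox: "prox u \<bullet> v = u \<bullet> prox v"
  by (simp add: prox_def inner_diff_left inner_diff_right symmetric_B)

lemma prox_psd: "0 \<le> z \<bullet> prox z"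
  using scaled_B_le[of z] by (simp add: prox_def inner_diff_right dot_square_norm)

lemma B_psd: "0 \<le> z \<bullet> B z"
  using dominates[of z] by (rule order_trans[rotated]) simp

lemma prox_norm: "(norm (prox z))\<^sup>2 \<le> \<beta> * (z \<bullet> prox z)"
proof (rule psd_norm_le[of UNIV])
  show "z \<bullet> prox z \<le> \<beta> * (norm z)\<^sup>2" for z
    using B_psd[of z] \<rho>_pos by (simp add: prox_def inner_diff_right dot_square_norm)
qed (simp_all add: linear_prox symmetric_prox prox_psd \<beta>_pos)

lemma mismatch_op_psd: "0 \<le> z \<bullet> mismatch_op z"
  using dominates[of z]
  by (simp add: mismatch_op_def inner_diff_right flip: adjoint_A dot_square_norm)

lemma lagrangian_primal_step:
  "lagrangian (x (Suc n)) (lam n)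
    \<le> lagrangian (x n) (lam n) - (\<beta> - (l + \<rho> * b) / 2) * (norm (increment n))\<^sup>2"
proof -
  let ?d = "increment n"
  have x: "x (Suc n) = x n + ?d" by (simp add: increment_def)
  have F: "F (x (Suc n)) \<le> F (x n) + g (x n) \<bullet> ?d + l / 2 * (norm ?d)\<^sup>2"
    using lipschitz_gradient_upper_bound[OF gradient lipschitz] by (simp add: increment_def)
  have "(g (x n) + At (lam n) + \<rho> *\<^sub>R B (x n)) \<bullet> ?d = - \<beta> * (norm ?d)\<^sup>2"
    using primal[of n] unfolding increment_def[symmetric]
    by (metis add.inverse_inverse dot_square_norm inner_minus_left inner_scaleR_left mult_minus_left)
  then have stat: "g (x n) \<bullet> ?d = - \<beta> * (norm ?d)\<^sup>2 - lam n \<bullet> A ?d - \<rho> * (x n \<bullet> B ?d)"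
    by (simp add: inner_add_left symmetric_B adjoint_A inner_commute[of "lam n"] inner_commute[of "At (lam n)"])
  have quad: "x (Suc n) \<bullet> B (x (Suc n)) = x n \<bullet> B (x n) + 2 * (x n \<bullet> B ?d) + ?d \<bullet> B ?d"
  proof -
    have "?d \<bullet> B (x n) = x n \<bullet> B ?d" using symmetric_B[of "x n" ?d] by (simp only: inner_commute)
    then show ?thesis
      unfolding x linear_add[OF linear_B] inner_add_left inner_add_right by simp
  qed
  have "\<rho> / 2 * (?d \<bullet> B ?d) \<le> \<rho> / 2 * (b * (norm ?d)\<^sup>2)"
    using \<rho>_pos by (intro mult_left_mono B_le) simp
  with F show ?thesis
    unfolding lagrangian_def quad stat
    unfolding x linear_add[OF linear_A] inner_add_right distrib_left distrib_right
      left_diff_distrib add_divide_distrib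
    by simp
qed

text \<open>
  Dual ascent raises the Lagrangian, so the Lagrangian alone is no Lyapunov function.
\<close>
lemma lagrangian_dual_step:
  "lagrangian (x (Suc n)) (lam (Suc n))
    = lagrangian (x (Suc n)) (lam n) + \<rho> * (norm (A (x (Suc n))))\<^sup>2"
  by (simp add: lagrangian_def dual inner_add_left dot_square_norm)

text \<open>
  The left side is \<open>A\<^sup>T (lam (n + 2) - lam (n + 1))\<close>.
\<close>
lemma dual_increment:
  "\<rho> *\<^sub>R At (A (x (Suc (Suc n))))
    = - (g (x (Suc n)) - g (x n)) - \<rho> *\<^sub>R mismatch_op (increment (Suc n))
      - prox (increment (Suc n) - increment n)"
proof -
  let ?x2 = "x (Suc (Suc n))" and ?x1 = "x (Suc n)" and ?x0 = "x n"
  have "At (lam (Suc n)) = At (lam n) + \<rho> *\<^sub>R At (A ?x1)"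
    by (simp add: dual linear_add[OF linear_At] linear_scale[OF linear_At])
  then have "\<beta> *\<^sub>R (?x2 - ?x1) - \<beta> *\<^sub>R (?x1 - ?x0)
      = - (g ?x1 - g ?x0) - \<rho> *\<^sub>R At (A ?x1) - \<rho> *\<^sub>R (B ?x1 - B ?x0)"
    unfolding primal by (simp add: algebra_simps)
  then show ?thesis
    by (simp add: prox_def mismatch_op_def increment_def linear_diff[OF linear_B]
        linear_diff[OF linear_A] linear_diff[OF linear_At] scaleR_diff_right)
qed

text \<open>
  The spectral gap turns the bound on \<open>A\<^sup>T\<close> of the dual increment into one on the dual increment itself,
  which already lies in the range of \<open>A\<close>.  The left side is exactly the amount by which the dual step raises the
  Lagrangian.
\<close>
lemma dual_increment_bound:
  "\<rho> * (norm (A (x (Suc (Suc n)))))\<^sup>2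
    \<le> \<kappa> / \<rho> * (4 * l\<^sup>2 * (norm (increment n))\<^sup>2 + 4 * \<rho>\<^sup>2 * q\<^sup>2 * (norm (increment (Suc n)))\<^sup>2
        + 2 * \<beta> * ((increment (Suc n) - increment n) \<bullet> prox (increment (Suc n) - increment n)))"
proof -
  let ?z = "x (Suc (Suc n))"
  let ?v = "increment (Suc n) - increment n"
  define r s t where "r = g (x (Suc n)) - g (x n)" and "s = \<rho> *\<^sub>R mismatch_op (increment (Suc n))"
    and "t = prox ?v"
  have "norm (\<rho> *\<^sub>R At (A ?z)) \<le> norm r + norm s + norm t"
    unfolding dual_increment r_def[symmetric] s_def[symmetric] t_def[symmetric]
    by (metis (no_types, opaque_lifting) add_mono_thms_linordered_semiring(3) norm_minus_cancel norm_triangle_ineq4 order_trans)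
  then have "(norm (\<rho> *\<^sub>R At (A ?z)))\<^sup>2 \<le> (norm r + norm s + norm t)\<^sup>2" by (intro power_mono) simp_all
  also have "\<dots> \<le> 4 * (norm r)\<^sup>2 + 4 * (norm s)\<^sup>2 + 2 * (norm t)\<^sup>2"
    using sum_squares_bound[of "norm r" "norm s"] sum_squares_bound[of "norm r + norm s" "norm t"]
    by (simp add: power2_eq_square algebra_simps)
  also have "(norm r)\<^sup>2 \<le> l\<^sup>2 * (norm (increment n))\<^sup>2"
    using lipschitz[of "x (Suc n)" "x n"] unfolding r_def increment_def power_mult_distrib[symmetric]
    by (intro power_mono) auto
  also have "(norm s)\<^sup>2 \<le> \<rho>\<^sup>2 * (q\<^sup>2 * (norm (increment (Suc n)))\<^sup>2)"
    using mismatch[of "increment (Suc n)"]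
    unfolding s_def mismatch_op_def[symmetric] norm_scaleR power_mult_distrib power2_abs
    by (intro mult_left_mono) (metis norm_ge_zero power_mono power_mult_distrib, simp)
  also have "(norm t)\<^sup>2 \<le> \<beta> * (?v \<bullet> prox ?v)" unfolding t_def by (rule prox_norm)
  finally have le: "\<rho>\<^sup>2 * (norm (At (A ?z)))\<^sup>2 \<le> 4 * l\<^sup>2 * (norm (increment n))\<^sup>2
      + 4 * \<rho>\<^sup>2 * q\<^sup>2 * (norm (increment (Suc n)))\<^sup>2 + 2 * \<beta> * (?v \<bullet> prox ?v)" (is "_ \<le> ?R")
    by (simp add: power_mult_distrib algebra_simps)
  have "\<rho> * (norm (A ?z))\<^sup>2 \<le> \<rho> * (\<kappa> * (norm (At (A ?z)))\<^sup>2)"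
    using \<rho>_pos by (intro mult_left_mono spectral_gap) simp
  also have "\<dots> = \<kappa> / \<rho> * (\<rho>\<^sup>2 * (norm (At (A ?z)))\<^sup>2)"
    using \<rho>_pos by (simp add: power2_eq_square)
  also have "\<dots> \<le> \<kappa> / \<rho> * ?R" using \<kappa>_nonneg \<rho>_pos by (intro mult_left_mono le) simp
  finally show ?thesis .
qed

text \<open>
  The second difference of the iterates appears in the bound on the dual step with a factor of order \<open>\<beta>\<close>,
  too large for the Lagrangian's decrease to absorb.  This energy decreases by a multiple of precisely that term, at
  the price of a multiple of \<open>l\<close> times squared increments.
\<close>
definition residual_energy :: "nat \<Rightarrow> real" where
  "residual_energy n = \<rho> / 2 * (norm (A (x (Suc n))))\<^sup>2 + 1 / 2 * (increment n \<bullet> prox (increment n))"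

text \<open>
  Take the inner product of the identity \<open>dual_increment\<close> with the newest primal increment and polarize both
  sides: the left one yields the change of \<open>\<parallel>A x\<parallel>\<^sup>2\<close>, the \<open>prox\<close> term the change of the increment's
  energy together with the energy of the second difference.
\<close>
lemma residual_energy_step:
  "residual_energy (Suc n)
      + 1 / 2 * ((increment (Suc n) - increment n) \<bullet> prox (increment (Suc n) - increment n))
    \<le> residual_energy n + l / 2 * ((norm (increment n))\<^sup>2 + (norm (increment (Suc n)))\<^sup>2)"
proof -
  let ?a1 = "A (x (Suc n))" and ?a2 = "A (x (Suc (Suc n)))"
  let ?w0 = "increment n" and ?w1 = "increment (Suc n)"
  have a: "A ?w1 = ?a2 - ?a1" by (simp add: increment_def linear_diff[OF linear_A])
  have "(\<rho> *\<^sub>R At ?a2) \<bullet> ?w1 = \<rho> * (?a2 \<bullet> (?a2 - ?a1))"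
    by (simp add: adjoint_A[symmetric] a[symmetric] inner_commute[of "At ?a2"] inner_commute[of "?a2"])
  also have "?a2 \<bullet> (?a2 - ?a1) = ((norm ?a2)\<^sup>2 - (norm ?a1)\<^sup>2 + (norm (?a2 - ?a1))\<^sup>2) / 2"
    by (simp add: power2_norm_eq_inner inner_diff_left inner_diff_right inner_commute field_simps)
  finally have lhs: "(\<rho> *\<^sub>R At ?a2) \<bullet> ?w1 \<ge> \<rho> / 2 * ((norm ?a2)\<^sup>2 - (norm ?a1)\<^sup>2)"
    using \<rho>_pos by (simp add: field_simps)
  have "(\<rho> *\<^sub>R At ?a2) \<bullet> ?w1 = - ((g (x (Suc n)) - g (x n)) \<bullet> ?w1)
      - \<rho> * (?w1 \<bullet> mismatch_op ?w1) - ?w1 \<bullet> prox (?w1 - ?w0)"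
    unfolding dual_increment by (simp add: inner_diff_left inner_diff_right inner_commute algebra_simps)
  moreover have "0 \<le> \<rho> * (?w1 \<bullet> mismatch_op ?w1)"
    using \<rho>_pos mismatch_op_psd by simp
  moreover have "- ((g (x (Suc n)) - g (x n)) \<bullet> ?w1) \<le> l / 2 * ((norm ?w0)\<^sup>2 + (norm ?w1)\<^sup>2)"
  proof -
    have "- ((g (x (Suc n)) - g (x n)) \<bullet> ?w1) = (g (x n) - g (x (Suc n))) \<bullet> ?w1"
      by (simp add: inner_diff_left)
    also have "\<dots> \<le> norm (g (x n) - g (x (Suc n))) * norm ?w1" by (rule norm_cauchy_schwarz)
    also have "\<dots> \<le> l * norm ?w0 * norm ?w1"
      using lipschitz[of "x n" "x (Suc n)"]
      by (intro mult_right_mono) (simp_all add: increment_def norm_minus_commute)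
    also have "\<dots> \<le> l * (((norm ?w0)\<^sup>2 + (norm ?w1)\<^sup>2) / 2)"
      using sum_squares_bound[of "norm ?w0" "norm ?w1"] l_pos
      unfolding mult.assoc by (intro mult_left_mono) auto
    finally show ?thesis by simp
  qed
  moreover have "?w1 \<bullet> prox (?w1 - ?w0)
      = 1 / 2 * (?w1 \<bullet> prox ?w1 - ?w0 \<bullet> prox ?w0 + (?w1 - ?w0) \<bullet> prox (?w1 - ?w0))"
  proof -
    have "?w0 \<bullet> prox ?w1 = ?w1 \<bullet> prox ?w0" using symmetric_prox[of ?w1 ?w0] by (simp only: inner_commute)
    then show ?thesis unfolding linear_diff[OF linear_prox] inner_diff_left inner_diff_right by simp
  qed
  ultimately show ?thesis using lhs unfolding residual_energy_def distrib_left right_diff_distrib by linarith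
qed

text \<open>
  The smallest weight for which the decrease of the energy cancels the second differences in
  \<open>dual_increment_bound\<close>.
\<close>
definition weight :: real where
  "weight = 4 * \<kappa> * \<beta> / \<rho>"

text \<open>
  The last summand moves the terms in the older increment, which arise in the bounds of the dual step and of the
  energy, from one step to the next.
\<close>
definition potential :: "nat \<Rightarrow> real" where
  "potential n = lagrangian (x (Suc n)) (lam (Suc n)) + weight * residual_energy n
     + (4 * \<kappa> * l\<^sup>2 / \<rho> + weight * l / 2) * (norm (increment n))\<^sup>2"

definition decrease :: real where
  "decrease = \<beta> - ((l + \<rho> * b) / 2 + \<kappa> / \<rho> * (4 * l\<^sup>2 + 4 * \<rho>\<^sup>2 * q\<^sup>2) + weight * l)"

lemma decrease_pos: "0 < decrease"
  using step_size by (simp add: decrease_def weight_def)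

lemma weight_nonneg: "0 \<le> weight"
  using \<kappa>_nonneg \<beta>_pos \<rho>_pos by (simp add: weight_def)

lemma potential_step:
  "potential (Suc n) \<le> potential n - decrease * (norm (increment (Suc n)))\<^sup>2"
proof -
  let ?V = "(increment (Suc n) - increment n) \<bullet> prox (increment (Suc n) - increment n)"
  have "weight * (residual_energy (Suc n) + 1 / 2 * ?V)
      \<le> weight * (residual_energy n + l / 2 * ((norm (increment n))\<^sup>2 + (norm (increment (Suc n)))\<^sup>2))"
    by (rule mult_left_mono[OF residual_energy_step weight_nonneg])
  moreover define k where "k = \<kappa> / \<rho>"
  moreover have "weight * (1 / 2 * ?V) = k * (2 * \<beta> * ?V)" by (simp add: weight_def k_def)
  moreover have "4 * \<kappa> * l\<^sup>2 / \<rho> = k * (4 * l\<^sup>2)" by (simp add: k_def)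
  ultimately show ?thesis
    using lagrangian_primal_step[of "Suc n"] lagrangian_dual_step[of "Suc n"] dual_increment_bound[of n]
    unfolding potential_def decrease_def k_def[symmetric]
    by (simp add: algebra_simps)
qed

text \<open>
  The multiplier term is the only one in the potential without a sign.  By the dual update,
  \<open>lam (n + 1) \<bullet> A (x (n + 1))\<close> is at least the telescoping difference of \<open>\<parallel>lam n\<parallel>\<^sup>2 / (2 \<rho>)\<close>.
\<close>
lemma potential_sum_lower_bound:
  "- (norm (lam 0))\<^sup>2 / (2 * \<rho>) \<le> (\<Sum>n<N. potential n)"
proof -
  have "((norm (lam N))\<^sup>2 - (norm (lam 0))\<^sup>2) / (2 * \<rho>) \<le> (\<Sum>n<N. potential n)"
  proof (induction N)
    case (Suc N)
    have "(norm (lam N))\<^sup>2 = (norm (lam (Suc N) - \<rho> *\<^sub>R A (x (Suc N))))\<^sup>2" by (simp add: dual)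
    also have "\<dots> \<ge> (norm (lam (Suc N)))\<^sup>2 - 2 * \<rho> * (lam (Suc N) \<bullet> A (x (Suc N)))"
      using \<rho>_pos by (simp add: power2_norm_eq_inner inner_diff_left inner_diff_right inner_commute)
    finally have "((norm (lam (Suc N)))\<^sup>2 - (norm (lam N))\<^sup>2) / (2 * \<rho>) \<le> lam (Suc N) \<bullet> A (x (Suc N))"
      using \<rho>_pos by (simp add: field_simps)
    also have "\<dots> \<le> potential N"
    proof -
      have "0 \<le> \<rho> / 2 * (x (Suc N) \<bullet> B (x (Suc N)))" using B_psd \<rho>_pos by simp
      moreover have "0 \<le> weight * residual_energy N"
        using weight_nonneg prox_psd \<rho>_pos by (simp add: residual_energy_def)
      moreover have "0 \<le> (4 * \<kappa> * l\<^sup>2 / \<rho> + weight * l / 2) * (norm (increment N))\<^sup>2"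
        using weight_nonneg l_pos \<kappa>_nonneg \<rho>_pos by simp
      ultimately show ?thesis
        using nonneg[of "x (Suc N)"] unfolding potential_def lagrangian_def by linarith
    qed
    finally show ?case using Suc by (simp add: diff_divide_distrib)
  qed simp
  moreover have "- (norm (lam 0))\<^sup>2 / (2 * \<rho>) \<le> ((norm (lam N))\<^sup>2 - (norm (lam 0))\<^sup>2) / (2 * \<rho>)"
    using \<rho>_pos by (intro divide_right_mono) simp_all
  ultimately show ?thesis by simp
qed

lemma potential_antimono: "m \<le> n \<Longrightarrow> potential n \<le> potential m"
proof (rule lift_Suc_antimono_le[of potential])
  show "potential (Suc k) \<le> potential k" for k
  proof -
    have "0 \<le> decrease * (norm (increment (Suc k)))\<^sup>2" using decrease_pos by simp
    then show ?thesis using potential_step[of k] by linarith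
  qed
qed

text \<open>
  A negative value would persist by monotonicity and drive the partial sums to minus infinity.
\<close>
lemma potential_nonneg: "0 \<le> potential n"
proof (rule ccontr)
  assume "\<not> 0 \<le> potential n"
  then have neg: "potential n < 0" by simp
  let ?C = "(\<Sum>k<n. potential k) + (norm (lam 0))\<^sup>2 / (2 * \<rho>)"
  obtain m :: nat where m: "?C < m * (- potential n)" using neg reals_Archimedean3[of "- potential n"] by auto
  have "(\<Sum>k<n + m. potential k) = (\<Sum>k<n. potential k) + (\<Sum>k=n..<n + m. potential k)"
    by (simp add: lessThan_atLeast0 sum.atLeastLessThan_concat)
  also have "(\<Sum>k=n..<n + m. potential k) \<le> (\<Sum>k=n..<n + m. potential n)"
    by (intro sum_mono potential_antimono) simp
  finally show False using m potential_sum_lower_bound[of "n + m"] by simp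
qed

lemma summable_increment: "summable (\<lambda>n. (norm (increment n))\<^sup>2)"
proof -
  have "summable (\<lambda>n. (norm (increment (Suc n)))\<^sup>2)"
  proof (rule summableI_nonneg_bounded)
    fix N
    have "decrease * (\<Sum>n<N. (norm (increment (Suc n)))\<^sup>2) \<le> potential 0 - potential N"
    proof (induction N)
      case (Suc N)
      then show ?case using potential_step[of N] by (simp add: algebra_simps)
    qed simp
    also have "\<dots> \<le> potential 0" using potential_nonneg[of N] by simp
    finally show "(\<Sum>n<N. (norm (increment (Suc n)))\<^sup>2) \<le> potential 0 / decrease"
      using decrease_pos by (simp add: field_simps)
  qed simp
  then show ?thesis by (subst (asm) summable_Suc_iff)
qed

text \<open>
  The dual increment is \<open>\<rho> A x\<close>, and it is controlled by the primal increments.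
\<close>
lemma summable_consensus: "summable (\<lambda>n. (norm (A (x n)))\<^sup>2)"
proof -
  define C where "C = \<kappa> / \<rho> * (4 * l\<^sup>2 + 4 * \<rho>\<^sup>2 * q\<^sup>2 + 4 * \<beta>\<^sup>2)"
  have "summable (\<lambda>n. (norm (A (x (Suc (Suc n)))))\<^sup>2)"
  proof (rule summable_comparison_test')
    let ?w0 = "\<lambda>n. (norm (increment n))\<^sup>2" and ?w1 = "\<lambda>n. (norm (increment (Suc n)))\<^sup>2"
    show "summable (\<lambda>n. C / \<rho> * (?w0 n + ?w1 n))"
      by (intro summable_mult summable_add summable_increment
          summable_Suc_iff[THEN iffD2, OF summable_increment])
    fix n
    let ?v = "increment (Suc n) - increment n"
    have "?v \<bullet> prox ?v \<le> \<beta> * (norm ?v)\<^sup>2"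
      using B_psd[of ?v] \<rho>_pos by (simp add: prox_def inner_diff_right dot_square_norm)
    also have "(norm ?v)\<^sup>2 \<le> 2 * (?w0 n + ?w1 n)"
      using zero_le_power2[of "norm (increment (Suc n) + increment n)"]
      by (simp add: power2_norm_eq_inner inner_simps inner_commute)
    finally have "2 * \<beta> * (?v \<bullet> prox ?v) \<le> 2 * \<beta> * (\<beta> * (2 * (?w0 n + ?w1 n)))" (is "?lhs \<le> ?rhs")
      using \<beta>_pos by (intro mult_left_mono) simp_all
    moreover have "?rhs = 4 * \<beta>\<^sup>2 * (?w0 n + ?w1 n)" by algebra
    ultimately have "2 * \<beta> * (?v \<bullet> prox ?v) \<le> 4 * \<beta>\<^sup>2 * (?w0 n + ?w1 n)"
      by simp
    moreover have "0 \<le> 4 * l\<^sup>2 * ?w1 n" "0 \<le> 4 * \<rho>\<^sup>2 * q\<^sup>2 * ?w0 n" by simp_all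
    ultimately have "4 * l\<^sup>2 * ?w0 n + 4 * \<rho>\<^sup>2 * q\<^sup>2 * ?w1 n + 2 * \<beta> * (?v \<bullet> prox ?v)
        \<le> (4 * l\<^sup>2 + 4 * \<rho>\<^sup>2 * q\<^sup>2 + 4 * \<beta>\<^sup>2) * (?w0 n + ?w1 n)"
      unfolding distrib_left distrib_right by linarith
    then have "\<kappa> / \<rho> * (4 * l\<^sup>2 * ?w0 n + 4 * \<rho>\<^sup>2 * q\<^sup>2 * ?w1 n + 2 * \<beta> * (?v \<bullet> prox ?v))
        \<le> C * (?w0 n + ?w1 n)"
      unfolding C_def mult.assoc[of "\<kappa> / \<rho>"] using \<kappa>_nonneg \<rho>_pos by (intro mult_left_mono) auto
    with dual_increment_bound[of n] have "\<rho> * (norm (A (x (Suc (Suc n)))))\<^sup>2 \<le> C * (?w0 n + ?w1 n)"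
      by (rule order_trans)
    then show "norm ((norm (A (x (Suc (Suc n)))))\<^sup>2) \<le> C / \<rho> * (?w0 n + ?w1 n)"
      using \<rho>_pos by (simp add: field_simps)
  qed
  then show ?thesis by (simp only: summable_Suc_iff[of "\<lambda>n. (norm (A (x (Suc n))))\<^sup>2"] summable_Suc_iff[of "\<lambda>n. (norm (A (x n)))\<^sup>2"])
qed

end

section \<open>Stacked vectors\<close>

text \<open>
  The \<open>k\<close>-th coordinates of all agents.  A matrix \<open>M \<otimes> I\<close> acts on each slice as \<open>M\<close>, so inequalities between
  quadratic forms pass from \<open>M\<close> to \<open>M \<otimes> I\<close> by summation over the slices.
\<close>
definition slice :: "real ^ ('n::finite \<times> 'p::finite) \<Rightarrow> 'p \<Rightarrow> real ^ 'n" where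
  "slice x k = (\<chi> i. x $ (i, k))"

lemma slice_nth [simp]: "slice x k $ i = x $ (i, k)"
  by (simp add: slice_def)

lemma block_nth [simp]: "block x i $ k = x $ (i, k)"
  by (simp add: block_def)

lemma eq_slicesI: "(\<And>k. slice x k = slice y k) \<Longrightarrow> x = y"
  by (auto simp: vec_eq_iff)

lemma eq_blocksI: "(\<And>i. block x i = block y i) \<Longrightarrow> x = y"
  by (auto simp: vec_eq_iff)

lemma inner_slices: "x \<bullet> y = (\<Sum>k\<in>UNIV. slice x k \<bullet> slice y k)"
proof -
  have "x \<bullet> y = (\<Sum>i\<in>UNIV. \<Sum>k\<in>UNIV. x $ (i, k) * y $ (i, k))"
    by (simp add: inner_vec_def sum.cartesian_product flip: UNIV_Times_UNIV)
  then show ?thesis by (simp add: inner_vec_def) (rule sum.swap)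
qed

lemma inner_blocks: "x \<bullet> y = (\<Sum>i\<in>UNIV. block x i \<bullet> block y i)"
  by (simp add: inner_vec_def sum.cartesian_product flip: UNIV_Times_UNIV)

lemma norm_slices: "(norm x)\<^sup>2 = (\<Sum>k\<in>UNIV. (norm (slice x k))\<^sup>2)"
  by (simp add: power2_norm_eq_inner inner_slices[of x])

lemma slice_kron: "slice (kron M (mat 1) *v x) k = M *v slice x k"
proof -
  have "(\<Sum>c\<in>UNIV. (M $ i $ fst c * (mat 1 $ k $ snd c)) * x $ c) = (\<Sum>j\<in>UNIV. M $ i $ j * x $ (j, k))" for i
  proof -
    have "(\<Sum>c\<in>UNIV. (M $ i $ fst c * (mat 1 $ k $ snd c)) * x $ c)
        = (\<Sum>j\<in>UNIV. \<Sum>k'\<in>UNIV. (M $ i $ j * (mat 1 $ k $ k')) * x $ (j, k'))"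
      by (simp add: sum.cartesian_product case_prod_unfold flip: UNIV_Times_UNIV)
    also have "\<dots> = (\<Sum>j\<in>UNIV. \<Sum>k'\<in>UNIV. if k = k' then M $ i $ j * x $ (j, k') else 0)"
      by (intro sum.cong refl) (simp add: mat_def)
    finally show ?thesis by simp
  qed
  then show ?thesis by (simp add: vec_eq_iff kron_def matrix_vector_mult_def)
qed

lemma block_kron: "block (kron M (mat 1) *v x) i = (\<Sum>j\<in>UNIV. M $ i $ j *\<^sub>R block x j)"
proof -
  have "(kron M (mat 1) *v x) $ (i, k) = (M *v slice x k) $ i" for k
    by (metis slice_kron slice_nth)
  then show ?thesis by (simp add: vec_eq_iff matrix_vector_mult_def)
qed

lemma kron_diff: "kron (M - N) P = kron M P - kron N P"
  by (simp add: kron_def vec_eq_iff left_diff_distrib)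

lemma kron_symmetric_inner:
  assumes "transpose M = M"
  shows "(kron M (mat 1) *v x) \<bullet> y = x \<bullet> (kron M (mat 1) *v y)"
  by (simp add: inner_slices slice_kron symmetric_matrix_inner[OF assms])

lemma kron_inner_le:
  assumes "\<And>v. v \<bullet> (M *v v) \<le> c * (v \<bullet> (N *v v))"
  shows "x \<bullet> (kron M (mat 1) *v x) \<le> c * (x \<bullet> (kron N (mat 1) *v x))"
  unfolding inner_slices slice_kron sum_distrib_left by (intro sum_mono assms)

lemma kron_inner_le_norm:
  assumes "\<And>v. v \<bullet> (M *v v) \<le> c * (norm v)\<^sup>2"
  shows "x \<bullet> (kron M (mat 1) *v x) \<le> c * (norm x)\<^sup>2"
  unfolding inner_slices slice_kron norm_slices sum_distrib_left by (intro sum_mono assms)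

lemma kron_inner_le_norm_image:
  assumes "\<And>v. v \<bullet> (M *v v) \<le> c * (norm (M *v v))\<^sup>2"
  shows "x \<bullet> (kron M (mat 1) *v x) \<le> c * (norm (kron M (mat 1) *v x))\<^sup>2"
  unfolding inner_slices slice_kron norm_slices sum_distrib_left by (intro sum_mono assms)

lemma norm_le_spectral_norm: "norm (M *v v) \<le> spectral_norm M * norm v"
  unfolding spectral_norm_def by (intro onorm matrix_vector_mul_bounded_linear)

lemma spectral_norm_nonneg: "0 \<le> spectral_norm M"
  unfolding spectral_norm_def by (intro onorm_pos_le matrix_vector_mul_bounded_linear)

lemma inner_le_spectral_norm: "v \<bullet> (M *v v) \<le> spectral_norm M * (norm v)\<^sup>2"
proof -
  have "v \<bullet> (M *v v) \<le> norm v * norm (M *v v)" by (rule norm_cauchy_schwarz)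
  also have "\<dots> \<le> norm v * (spectral_norm M * norm v)"
    by (intro mult_left_mono norm_le_spectral_norm) simp
  finally show ?thesis by (simp add: power2_eq_square mult_ac)
qed

lemma norm_kron_le: "norm (kron M (mat 1) *v x) \<le> spectral_norm M * norm x"
proof (rule power2_le_imp_le)
  have "(norm (kron M (mat 1) *v x))\<^sup>2 = (\<Sum>k\<in>UNIV. (norm (M *v slice x k))\<^sup>2)"
    by (simp add: norm_slices slice_kron)
  also have "\<dots> \<le> (\<Sum>k\<in>UNIV. (spectral_norm M * norm (slice x k))\<^sup>2)"
    by (intro sum_mono power_mono norm_le_spectral_norm) simp
  also have "\<dots> = (spectral_norm M * norm x)\<^sup>2"
    by (simp add: power_mult_distrib norm_slices[of x] sum_distrib_left)
  finally show "(norm (kron M (mat 1) *v x))\<^sup>2 \<le> (spectral_norm M * norm x)\<^sup>2" .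
qed (simp add: spectral_norm_nonneg)

lemma block_grad_total_cost:
  fixes f :: "'n::finite \<Rightarrow> real ^ 'p::finite \<Rightarrow> real" and x :: "real ^ ('n \<times> 'p)"
  assumes "\<And>i z. f i differentiable (at z)"
  shows "block (grad (total_cost f) x) i = grad (f i) (block x i)"
proof -
  define D where "D = (\<chi> c. grad (f (fst c)) (block x (fst c)) $ snd c)"
  have block_D: "block D i = grad (f i) (block x i)" for i by (simp add: D_def vec_eq_iff)
  have "(total_cost f has_derivative (\<lambda>h. \<Sum>i\<in>UNIV. block h i \<bullet> block D i)) (at x)"
    unfolding total_cost_def
  proof (rule has_derivative_sum)
    fix i :: 'n
    have lin: "linear (\<lambda>z :: real ^ ('n \<times> 'p). block z i)" by (rule linearI) (simp_all add: vec_eq_iff)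
    have "((\<lambda>z. block z i) has_derivative (\<lambda>h. block h i)) (at x)"
      by (rule bounded_linear_imp_has_derivative) (simp add: lin flip: linear_conv_bounded_linear)
    moreover have "(f i has_derivative (\<lambda>h. h \<bullet> block D i)) (at (block x i))"
      using GDERIV_grad[OF assms] by (simp add: gderiv_def block_D)
    ultimately show "((\<lambda>z. f i (block z i)) has_derivative (\<lambda>h. block h i \<bullet> block D i)) (at x)"
      by (rule has_derivative_compose)
  qed
  then have "GDERIV (total_cost f) x :> D" by (simp add: gderiv_def inner_blocks)
  then show ?thesis by (simp add: grad_eqI block_D)
qed

section \<open>Mixing matrices\<close>

text \<open>
  Only the component \<open>z\<close> of \<open>v\<close> orthogonal to \<open>e\<close> matters.  For it, the Cauchy-Schwarz inequality
  \<open>(z \<bullet> M z)\<^sup>2 \<le> \<parallel>z\<parallel>\<^sup>2 \<parallel>M z\<parallel>\<^sup>2\<close> combines with the gap into the claim.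
\<close>
lemma inner_le_norm_image_of_gap:
  fixes M :: "real ^ 'n ^ 'n"
  assumes sym: "transpose M = M" and e: "M *v e = 0" and \<sigma>: "0 < \<sigma>"
    and gap: "\<And>z. e \<bullet> z = 0 \<Longrightarrow> \<sigma> * (norm z)\<^sup>2 \<le> z \<bullet> (M *v z)"
  shows "v \<bullet> (M *v v) \<le> 1 / \<sigma> * (norm (M *v v))\<^sup>2"
proof -
  define z where "z = v - ((e \<bullet> v) / (e \<bullet> e)) *\<^sub>R e"
  have ez: "e \<bullet> z = 0" by (cases "e = 0") (simp_all add: z_def inner_diff_right)
  have Mz: "M *v v = M *v z"
    by (simp add: z_def matrix_vector_mult_diff_distrib matrix_vector_mult_scaleR e)
  let ?s = "z \<bullet> (M *v z)"
  have s: "v \<bullet> (M *v v) = ?s"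
    unfolding Mz symmetric_matrix_inner[OF sym, symmetric] by (simp add: Mz)
  have pos: "0 \<le> ?s" using gap[OF ez] \<sigma> by (smt (verit) mult_nonneg_nonneg zero_le_power2)
  have "\<sigma> * ?s\<^sup>2 \<le> \<sigma> * ((norm z)\<^sup>2 * (norm (M *v z))\<^sup>2)"
    using \<sigma> Cauchy_Schwarz_ineq[of z "M *v z"] by (simp add: power2_norm_eq_inner)
  also have "\<dots> \<le> ?s * (norm (M *v z))\<^sup>2"
    unfolding mult.assoc[symmetric] by (intro mult_right_mono gap ez) simp
  finally have "?s * (\<sigma> * ?s) \<le> ?s * (norm (M *v z))\<^sup>2" by (simp add: power2_eq_square mult_ac)
  then have "\<sigma> * ?s \<le> (norm (M *v z))\<^sup>2" using pos by (cases "?s = 0") auto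
  then have "?s \<le> 1 / \<sigma> * (norm (M *v z))\<^sup>2" using \<sigma> by (simp add: field_simps)
  then show ?thesis using s by (simp add: Mz)
qed

lemma matrix_inner_diff:
  fixes M N :: "real ^ 'n ^ 'n"
  shows "v \<bullet> ((M - N) *v v) = v \<bullet> (M *v v) - v \<bullet> (N *v v)"
  by (simp add: matrix_vector_mult_diff_rdistrib inner_diff_right)

text \<open>
  Everything about the mixing matrices is phrased through the forms of \<open>mat 1 - Wt\<close> (the complement) and
  \<open>Wt - W\<close> (the difference).  The two Loewner bounds of admissibility say that these forms are equivalent:
  the difference is at most the complement, and the complement at most \<open>(1 + \<rho>) / \<rho>\<close> times the difference.
\<close>
locale admissible_mixing =
  fixes E :: "('n::finite \<times> 'n) set" and \<rho> :: real and W Wt :: "real ^ 'n ^ 'n"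
  assumes admissible: "admissible E \<rho> W Wt" and \<rho>_pos: "0 < \<rho>"
begin

lemma symmetric: "transpose (mat 1 - Wt) = mat 1 - Wt" "transpose (Wt - W) = Wt - W"
    "transpose W = W" "transpose (mat 1 - W) = mat 1 - W"
proof -
  have "W $ i $ j = W $ j $ i" "Wt $ i $ j = Wt $ j $ i" for i j
    using admissible unfolding admissible_def transpose_def vec_eq_iff by (metis vec_lambda_beta)+
  then show "transpose (mat 1 - Wt) = mat 1 - Wt" "transpose (Wt - W) = Wt - W"
    "transpose W = W" "transpose (mat 1 - W) = mat 1 - W"
    by (auto simp: transpose_def vec_eq_iff mat_def)
qed

lemma ones_kernel: "(mat 1 - Wt) *v 1 = 0" "(Wt - W) *v 1 = 0" "W *v 1 = 1"
proof -
  show *: "(mat 1 - Wt) *v 1 = 0"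
    using admissible span_base[of 1 "{1}"] by (auto simp: admissible_def null_space_def)
  have "(W - Wt) *v 1 = 0"
    using admissible span_base[of 1 "{1}"] by (auto simp: admissible_def null_space_def)
  then show "(Wt - W) *v 1 = 0" "W *v 1 = 1"
    using * by (simp_all add: matrix_vector_mult_diff_rdistrib)
qed

lemma difference_le_complement: "v \<bullet> ((Wt - W) *v v) \<le> v \<bullet> ((mat 1 - Wt) *v v)"
proof -
  have "0 \<le> v \<bullet> (((1 / 2) *\<^sub>R (mat 1 + W) - Wt) *v v)"
    using admissible by (simp add: admissible_def loewner_le_def psd_def)
  then show ?thesis
    by (simp add: matrix_inner_diff scaleR_matrix_vector_assoc[symmetric] matrix_vector_mult_add_rdistrib
        inner_add_right field_simps)
qed

lemma complement_le_difference: "v \<bullet> ((mat 1 - Wt) *v v) \<le> (1 + \<rho>) / \<rho> * (v \<bullet> ((Wt - W) *v v))"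
proof -
  let ?a = "v \<bullet> v" and ?w = "v \<bullet> (W *v v)" and ?t = "v \<bullet> (Wt *v v)"
  have "0 \<le> v \<bullet> ((Wt - (1 / (1 / \<rho> + 2)) *\<^sub>R (mat 1 + (1 / \<rho> + 1) *\<^sub>R W)) *v v)"
    using admissible by (simp only: admissible_def loewner_le_def psd_def)
  then have "(1 / (1 / \<rho> + 2)) * (?a + (1 / \<rho> + 1) * ?w) \<le> ?t"
    by (simp add: matrix_inner_diff scaleR_matrix_vector_assoc[symmetric] matrix_vector_mult_add_rdistrib
        inner_add_right)
  moreover have "1 / (1 / \<rho> + 2) = \<rho> / (1 + 2 * \<rho>)" "1 / \<rho> + 1 = (1 + \<rho>) / \<rho>"
    using \<rho>_pos by (simp_all add: field_simps)
  ultimately have "\<rho> / (1 + 2 * \<rho>) * (?a + (1 + \<rho>) / \<rho> * ?w) \<le> ?t" by metis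
  then have "\<rho> * (?a + (1 + \<rho>) / \<rho> * ?w) \<le> (1 + 2 * \<rho>) * ?t"
    using \<rho>_pos by (simp add: pos_divide_le_eq mult.commute)
  moreover have "\<rho> * (?a + (1 + \<rho>) / \<rho> * ?w) = \<rho> * ?a + (1 + \<rho>) * ?w"
    using \<rho>_pos by (simp add: distrib_left)
  ultimately have "\<rho> * ?a + (1 + \<rho>) * ?w \<le> (1 + 2 * \<rho>) * ?t" by simp
  then show ?thesis
    using \<rho>_pos by (simp add: matrix_inner_diff field_simps)
qed

text \<open>
  The two comparisons bound the form by a multiple of itself with a factor above one.
\<close>
lemma difference_psd: "0 \<le> v \<bullet> ((Wt - W) *v v)"
proof -
  let ?s = "v \<bullet> ((Wt - W) *v v)"
  have "?s \<le> (1 + \<rho>) / \<rho> * ?s" using difference_le_complement complement_le_difference by (rule order_trans)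
  also have "(1 + \<rho>) / \<rho> * ?s = ?s + ?s / \<rho>" using \<rho>_pos by (simp add: field_simps)
  finally show ?thesis using \<rho>_pos by (simp add: zero_le_divide_iff)
qed

lemma laplacian_split: "v \<bullet> ((mat 1 - W) *v v) = v \<bullet> ((mat 1 - Wt) *v v) + v \<bullet> ((Wt - W) *v v)"
  by (simp add: matrix_inner_diff)

lemma laplacian_le_difference: "v \<bullet> ((mat 1 - W) *v v) \<le> (1 + 2 * \<rho>) / \<rho> * (v \<bullet> ((Wt - W) *v v))"
  using complement_le_difference[of v] \<rho>_pos by (simp add: laplacian_split field_simps)

lemma difference_definite:
  assumes "v \<noteq> 0" "1 \<bullet> v = 0"
  shows "0 < v \<bullet> ((Wt - W) *v v)"
proof (rule ccontr)
  assume "\<not> ?thesis"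
  then have "v \<bullet> ((Wt - W) *v v) = 0" using difference_psd[of v] by simp
  moreover have "(norm ((Wt - W) *v v))\<^sup>2
      \<le> (spectral_norm (Wt - W) + 1) * (v \<bullet> ((Wt - W) *v v))"
  proof (rule psd_norm_le[of UNIV])
    show "z \<bullet> ((Wt - W) *v z) \<le> (spectral_norm (Wt - W) + 1) * (norm z)\<^sup>2" for z
      using inner_le_spectral_norm[of z "Wt - W"] by (simp add: distrib_right add_increasing2)
  qed (use difference_psd spectral_norm_nonneg[of "Wt - W"] symmetric_matrix_inner[OF symmetric(2)] in auto)
  ultimately have "(W - Wt) *v v = 0" by (simp add: matrix_vector_mult_diff_rdistrib)
  then have "v \<in> span {1}" using admissible by (auto simp: admissible_def null_space_def)
  then obtain c where "v = c *\<^sub>R 1" by (auto simp: span_singleton)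
  moreover have "(1 :: real ^ 'n) \<bullet> 1 \<noteq> 0" by simp
  ultimately show False using assms by simp
qed

text \<open>
  The ones vector is the only direction in which the form of \<open>mat 1 - W\<close> vanishes, so on its orthogonal
  complement that form is at least \<open>1 - lambda_2 W\<close>; the comparison with the difference loses the other factor.
\<close>
lemma difference_ge_lambda_2:
  assumes "1 \<bullet> z = 0"
  shows "\<rho> * (1 - lambda_2 W) / (1 + 2 * \<rho>) * (norm z)\<^sup>2 \<le> z \<bullet> ((Wt - W) *v z)"
proof -
  have "z \<bullet> (W *v z) \<le> lambda_2 W * (norm z)\<^sup>2"
  proof (rule rayleigh_le_lambda_2[OF symmetric(3) _ _ _ assms, where s = 1])
    fix v :: "real ^ 'n" assume "v \<noteq> 0" "1 \<bullet> v = 0"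
    then have "0 < v \<bullet> ((Wt - W) *v v)" by (rule difference_definite)
    then have "0 < v \<bullet> ((mat 1 - W) *v v)"
      using laplacian_split[of v] difference_le_complement[of v] by linarith
    then show "v \<bullet> (W *v v) < 1 * (norm v)\<^sup>2" by (simp add: matrix_inner_diff dot_square_norm)
  qed (simp_all add: ones_kernel)
  then have "(1 - lambda_2 W) * (norm z)\<^sup>2 \<le> z \<bullet> ((mat 1 - W) *v z)"
    by (simp add: matrix_inner_diff dot_square_norm left_diff_distrib)
  also have "\<dots> \<le> (1 + 2 * \<rho>) / \<rho> * (z \<bullet> ((Wt - W) *v z))" by (rule laplacian_le_difference)
  finally show ?thesis using \<rho>_pos by (simp add: field_simps)
qed

lemma difference_le_image:
  assumes "lambda_2 W < 1"
  shows "v \<bullet> ((Wt - W) *v v) \<le> (1 + 2 * \<rho>) / (\<rho> * (1 - lambda_2 W)) * (norm ((Wt - W) *v v))\<^sup>2"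
proof -
  have "0 < \<rho> * (1 - lambda_2 W) / (1 + 2 * \<rho>)" using assms \<rho>_pos by simp
  from inner_le_norm_image_of_gap[OF symmetric(2) ones_kernel(2) this difference_ge_lambda_2]
  show ?thesis by simp
qed

end

section \<open>Convergence rate\<close>

text \<open>
  Before the hitting time \<open>N\<close> every term exceeds \<open>\<epsilon>\<close>, so \<open>N * \<epsilon>\<close> is at most the total sum.
\<close>
lemma summable_imp_hitting_time_rate:
  fixes gap :: "nat \<Rightarrow> real"
  assumes summable: "summable gap" and nonneg: "\<And>n. 0 \<le> gap n"
  shows "\<forall>\<epsilon>>0. \<exists>r. gap r \<le> \<epsilon>"
    and "(\<lambda>\<epsilon>. real (hitting_time gap \<epsilon>)) \<in> O[at_right 0](\<lambda>\<epsilon>. 1 / \<epsilon>)"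
proof -
  show "\<forall>\<epsilon>>0. \<exists>r. gap r \<le> \<epsilon>"
  proof (intro allI impI)
    fix \<epsilon> :: real assume "0 < \<epsilon>"
    then have "eventually (\<lambda>n. gap n < \<epsilon>) sequentially"
      using summable_LIMSEQ_zero[OF summable] by (rule order_tendstoD(2)[rotated])
    then show "\<exists>r. gap r \<le> \<epsilon>" by (auto simp: eventually_sequentially intro: less_imp_le)
  qed
  have bound: "real (hitting_time gap \<epsilon>) \<le> suminf gap * (1 / \<epsilon>)" if "0 < \<epsilon>" for \<epsilon>
  proof -
    let ?N = "hitting_time gap \<epsilon>"
    have "\<epsilon> \<le> gap r" if "r < ?N" for r
      using not_less_Least[of r "\<lambda>r. gap r \<le> \<epsilon>"] that by (simp add: hitting_time_def)
    then have "(\<Sum>r<?N. \<epsilon>) \<le> (\<Sum>r<?N. gap r)" by (intro sum_mono) simp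
    also have "\<dots> \<le> suminf gap" by (intro sum_le_suminf summable) (simp_all add: nonneg)
    finally show ?thesis using that by (simp add: field_simps)
  qed
  show "(\<lambda>\<epsilon>. real (hitting_time gap \<epsilon>)) \<in> O[at_right 0](\<lambda>\<epsilon>. 1 / \<epsilon>)"
  proof (rule bigoI[of _ "suminf gap"])
    show "\<forall>\<^sub>F \<epsilon> in at_right 0. norm (real (hitting_time gap \<epsilon>)) \<le> suminf gap * norm (1 / \<epsilon>)"
      using eventually_at_right_less by (rule eventually_mono) (use bound in auto)
  qed
qed

lemma tendsto_zero_of_norm_square_le:
  fixes u :: "nat \<Rightarrow> 'a::real_normed_vector"
  assumes "\<And>n. (norm (u n))\<^sup>2 \<le> c * s n" and "s \<longlonglongrightarrow> 0"
  shows "u \<longlonglongrightarrow> 0"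
proof -
  have "(\<lambda>n. sqrt (c * s n)) \<longlonglongrightarrow> 0"
    using tendsto_real_sqrt[OF tendsto_mult_right_zero[OF assms(2), of c]] by simp
  moreover have "norm (u n) \<le> sqrt (c * s n)" for n using assms(1) by (simp add: real_le_rsqrt)
  ultimately show ?thesis by (intro Lim_null_comparison[of u]) simp_all
qed

section \<open>Convergence of TT-EXTRA\<close>

text \<open>
  Summing over the agents removes every consensus force, since the matrices involved are symmetric and annihilate
  the ones vector.
\<close>
lemma kron_ones_annihilates:
  fixes M :: "real ^ 'n ^ 'n"
  assumes "transpose M = M" "M *v 1 = 0"
  shows "kron (rowvector 1 :: real ^ 'n ^ 1) (mat 1) *v (kron M (mat 1) *v z) = 0"
proof (rule eq_slicesI)
  fix k
  have "(rowvector 1 :: real ^ 'n ^ 1) *v (M *v v) = 0" for v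
  proof -
    have "1 \<bullet> (M *v v) = 0" using symmetric_matrix_inner[OF assms(1), of 1 v] assms(2) by simp
    then show ?thesis
      by (simp add: vec_eq_iff matrix_vector_mult_def rowvector_def inner_vec_def)
  qed
  then show "slice (kron (rowvector 1 :: real ^ 'n ^ 1) (mat 1) *v (kron M (mat 1) *v z)) k = slice 0 k"
    by (simp add: slice_kron vec_eq_iff)
qed

lemma norm_add_square_le:
  fixes u v :: "'a::real_inner"
  shows "(norm (u + v))\<^sup>2 \<le> 2 * (norm u)\<^sup>2 + 2 * (norm v)\<^sup>2"
  using zero_le_power2[of "norm (u - v)"]
  by (simp add: power2_norm_eq_inner inner_add_left inner_add_right inner_diff_left inner_diff_right inner_commute)

lemma tt_extra_dual_variable:
  fixes A :: "real ^ ('n::finite \<times> 'p::finite) ^ 'm::finite"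
  assumes A: "transpose A ** A = kron (Wt - W) (mat 1)"
    and tt: "tt_extra f W Wt \<rho> \<beta> x y" and dual: "dual_iterates A \<rho> x lam"
  shows "y r = transpose A *v lam r"
proof -
  have AtA: "block (transpose A *v (A *v z)) i = (\<Sum>j\<in>UNIV. (Wt $ i $ j - W $ i $ j) *\<^sub>R block z j)" for z i
    unfolding matrix_vector_mul_assoc A by (simp add: block_kron)
  have lin: "block (u + \<rho> *\<^sub>R v) i = block u i + \<rho> *\<^sub>R block v i" for u v :: "real ^ ('n \<times> 'p)" and i
    by (simp add: vec_eq_iff)
  show ?thesis
  proof (induction r)
    case 0
    have "lam 0 = 0 + \<rho> *\<^sub>R (A *v x 0)" using dual by (simp add: dual_iterates_def)
    then have "transpose A *v lam 0 = 0 + \<rho> *\<^sub>R (transpose A *v (A *v x 0))"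
      by (simp only: matrix_vector_mult_scaleR add_0)
    then show ?case using tt unfolding tt_extra_def by (intro eq_blocksI) (simp only: lin AtA, simp add: vec_eq_iff)
  next
    case (Suc r)
    have "lam (Suc r) = lam r + \<rho> *\<^sub>R (A *v x (Suc r))" using dual by (simp add: dual_iterates_def)
    then have "transpose A *v lam (Suc r) = y r + \<rho> *\<^sub>R (transpose A *v (A *v x (Suc r)))"
      by (simp only: Suc matrix_vector_mult_scaleR matrix_vector_right_distrib)
    then show ?case using tt unfolding tt_extra_def by (intro eq_blocksI) (simp only: lin AtA)
  qed
qed

lemma tt_extra_primal_step:
  fixes A :: "real ^ ('n::finite \<times> 'p::finite) ^ 'm::finite"
  assumes \<beta>: "\<beta> > 0" and diff: "\<And>i z. f i differentiable (at z)"
    and A: "transpose A ** A = kron (Wt - W) (mat 1)"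
    and tt: "tt_extra f W Wt \<rho> \<beta> x y" and dual: "dual_iterates A \<rho> x lam"
  shows "\<beta> *\<^sub>R (x (Suc r) - x r)
    = - (grad (total_cost f) (x r) + transpose A *v lam r + \<rho> *\<^sub>R (kron (mat 1 - Wt) (mat 1) *v x r))"
proof (rule eq_blocksI)
  fix i
  let ?s = "\<Sum>j\<in>UNIV. Wt $ i $ j *\<^sub>R block (x r) j"
  have diag: "(\<Sum>j\<in>UNIV. (mat 1 :: real ^ 'n ^ 'n) $ i $ j *\<^sub>R block (x r) j) = block (x r) i"
  proof -
    have "(\<Sum>j\<in>UNIV. (mat 1 :: real ^ 'n ^ 'n) $ i $ j *\<^sub>R block (x r) j)
        = (\<Sum>j\<in>UNIV. if i = j then block (x r) j else 0)"
      by (intro sum.cong) (simp_all add: mat_def)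
    then show ?thesis by simp
  qed
  have B: "block (kron (mat 1 - Wt) (mat 1) *v x r) i = block (x r) i - ?s"
    by (simp add: block_kron scaleR_left_diff_distrib sum_subtractf diag)
  have "block (x (Suc r)) i = (1 - \<rho> / \<beta>) *\<^sub>R block (x r) i
      - (1 / \<beta>) *\<^sub>R grad (f i) (block (x r) i) + (\<rho> / \<beta>) *\<^sub>R ?s - (1 / \<beta>) *\<^sub>R block (y r) i"
    using tt by (simp add: tt_extra_def)
  then have "\<beta> *\<^sub>R (block (x (Suc r)) i - block (x r) i)
      = - (grad (f i) (block (x r) i) + block (y r) i + \<rho> *\<^sub>R (block (x r) i - ?s))"
    using \<beta> by (simp add: scaleR_right_diff_distrib scaleR_left_diff_distrib scaleR_right_distrib)
  then have "\<beta> *\<^sub>R (block (x (Suc r)) i - block (x r) i)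
      = - (block (grad (total_cost f) (x r)) i + block (transpose A *v lam r) i
          + \<rho> *\<^sub>R block (kron (mat 1 - Wt) (mat 1) *v x r) i)"
    by (simp only: B block_grad_total_cost[OF diff] tt_extra_dual_variable[OF A tt dual])
  then show "block (\<beta> *\<^sub>R (x (Suc r) - x r)) i
    = block (- (grad (total_cost f) (x r) + transpose A *v lam r
        + \<rho> *\<^sub>R (kron (mat 1 - Wt) (mat 1) *v x r))) i"
    by (simp add: vec_eq_iff del: transpose_matrix_vector)
qed

theorem theorem2p1:
  fixes E :: "('n::finite \<times> 'n) set"
    and f :: "'n \<Rightarrow> real ^ 'p::finite \<Rightarrow> real"
    and W Wt :: "real ^ 'n ^ 'n"
    and A :: "real ^ ('n \<times> 'p) ^ 'm::finite"
    and \<rho> \<beta> l L a :: real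
    and x y :: "nat \<Rightarrow> real ^ ('n \<times> 'p)"
    and lam :: "nat \<Rightarrow> real ^ 'm"
  assumes "CARD('n) \<ge> 2"
    and "connected_undirected E"
    and "\<rho> > 0" and "\<beta> > 0"
    and "\<And>i z. f i differentiable (at z)"
    and "\<And>z. total_cost f differentiable (at z)"
    and "smooth l (total_cost f)"
    and "\<And>z. total_cost f z \<ge> 0"
    and "admissible E \<rho> W Wt"
    and "transpose A ** A = kron (Wt - W) (mat 1)"
    and "L = l + \<rho> * spectral_norm (mat 1 - Wt)"
    and "1 < a" and "a \<le> \<rho>\<^sup>2 * (1 - lambda_2 W) / (4 * l * (1 + 2 * \<rho>))"
    and "\<rho> > 1 + lambda_max (Wt - W)"
    and "\<rho> > (8 * l + sqrt (64 * l\<^sup>2 + 16 * l * (1 - lambda_2 W))) / (2 * (1 - lambda_2 W))"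
    and "\<beta> > (\<rho> + 1) * lambda_max (Wt - W) + 1"
    and "\<beta> > (L / 2 + (1 + 2 * \<rho>) / (\<rho>\<^sup>2 * (1 - lambda_2 W))
                * (4 * l\<^sup>2 + 4 * \<rho>\<^sup>2 * (spectral_norm (mat 1 - Wt - (Wt - W)))\<^sup>2))
             / (1 - 1 / a)"
    and "tt_extra f W Wt \<rho> \<beta> x y"
    and "dual_iterates A \<rho> x lam"
  shows "((\<lambda>r. kron (mat 1 - W) (mat 1 :: real ^ 'p ^ 'p) *v x r) \<longlonglongrightarrow> 0) \<and>
    ((\<lambda>r. kron (rowvector 1 :: real ^ 'n ^ 1) (mat 1 :: real ^ 'p ^ 'p)
           *v grad (total_cost f) (x r)) \<longlonglongrightarrow> 0) \<and>
    (\<forall>\<epsilon>>0. \<exists>r. optimality_gap f Wt A (x r) (lam r) \<le> \<epsilon>) \<and>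
    (\<lambda>\<epsilon>. real (hitting_time (\<lambda>r. optimality_gap f Wt A (x r) (lam r)) \<epsilon>))
      \<in> O[at_right 0](\<lambda>\<epsilon>. 1 / \<epsilon>)"
proof -
  note \<rho> = assms(3) and \<beta> = assms(4) and diff = assms(5) and fdiff = assms(6)
    and smooth = assms(7) and nonneg = assms(8) and A = assms(10) and L = assms(11)
    and a = assms(12,13) and \<beta>1 = assms(16) and \<beta>2 = assms(17) and tt = assms(18) and dual_it = assms(19)
  interpret mix: admissible_mixing E \<rho> W Wt using assms(9) \<rho> by unfold_locales
  let ?B = "kron (mat 1 - Wt) (mat 1 :: real ^ 'p ^ 'p)"
  let ?S = "kron (Wt - W) (mat 1 :: real ^ 'p ^ 'p)"
  let ?b = "spectral_norm (mat 1 - Wt)"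
  let ?q = "spectral_norm (mat 1 - Wt - (Wt - W))"
  define \<kappa> where "\<kappa> = (1 + 2 * \<rho>) / (\<rho> * (1 - lambda_2 W))"
  have l: "0 < l" and lip: "\<And>u v. norm (grad (total_cost f) u - grad (total_cost f) v) \<le> l * norm (u - v)"
    using smooth by (simp_all add: smooth_def)
  have lam2: "lambda_2 W < 1"
  proof -
    have "0 < \<rho>\<^sup>2 * (1 - lambda_2 W) / (4 * l * (1 + 2 * \<rho>))" using a by simp
    moreover have "0 < 4 * l * (1 + 2 * \<rho>)" using \<rho> l by simp
    ultimately have "0 < \<rho>\<^sup>2 * (1 - lambda_2 W)" by (simp only: zero_less_divide_iff) linarith
    then show ?thesis using \<rho> by (simp add: zero_less_mult_iff)
  qed
  then have \<kappa>: "0 < \<kappa>" using \<rho> by (simp add: \<kappa>_def)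
  have adj: "(A *v z) \<bullet> u = z \<bullet> (transpose A *v u)" for z u
    by (metis dot_lmul_matrix inner_commute transpose_matrix_vector)
  have AtA: "transpose A *v (A *v z) = ?S *v z" for z by (simp only: matrix_vector_mul_assoc A)
  have Az: "(norm (A *v z))\<^sup>2 = z \<bullet> (?S *v z)" for z
    by (simp only: power2_norm_eq_inner adj AtA)
  have \<kappa>_div: "\<kappa> / \<rho> = (1 + 2 * \<rho>) / (\<rho>\<^sup>2 * (1 - lambda_2 W))"
    by (simp add: \<kappa>_def power2_eq_square)
  \<comment> \<open>The upper bound on \<open>a\<close> reserves the share \<open>\<beta> / a\<close> of the primal decrease for the last summand of
     the step size condition.\<close>
  have "4 * \<kappa> * l / \<rho> = 1 / (\<rho>\<^sup>2 * (1 - lambda_2 W) / (4 * l * (1 + 2 * \<rho>)))"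
    by (simp add: \<kappa>_def power2_eq_square algebra_simps)
  also have "\<dots> \<le> 1 / a" using a by (intro frac_le) auto
  finally have "\<beta> * (4 * \<kappa> * l / \<rho>) \<le> \<beta> * (1 / a)" using \<beta> by (intro mult_left_mono) simp_all
  moreover have "(L / 2 + \<kappa> / \<rho> * (4 * l\<^sup>2 + 4 * \<rho>\<^sup>2 * ?q\<^sup>2)) < \<beta> * (1 - 1 / a)"
    using \<beta>2 a unfolding \<kappa>_div by (subst (asm) pos_divide_less_eq) (simp_all add: mult.commute)
  ultimately have step: "(l + \<rho> * ?b) / 2 + \<kappa> / \<rho> * (4 * l\<^sup>2 + 4 * \<rho>\<^sup>2 * ?q\<^sup>2) + 4 * \<kappa> * \<beta> * l / \<rho> < \<beta>"
    by (simp add: L right_diff_distrib mult_ac)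
  have scaled: "\<rho> * (v \<bullet> ((mat 1 - Wt) *v v)) \<le> \<beta> * (norm v)\<^sup>2" for v
  proof -
    have "\<rho> * (v \<bullet> ((mat 1 - Wt) *v v)) \<le> (1 + \<rho>) * (v \<bullet> ((Wt - W) *v v))"
      using mix.complement_le_difference[of v] \<rho> by (simp add: field_simps)
    also have "\<dots> \<le> (1 + \<rho>) * (lambda_max (Wt - W) * (norm v)\<^sup>2)"
      using \<rho> by (intro mult_left_mono rayleigh_le_lambda_max mix.symmetric) simp
    also have "\<dots> = ((\<rho> + 1) * lambda_max (Wt - W)) * (norm v)\<^sup>2" by simp
    also have "\<dots> \<le> \<beta> * (norm v)\<^sup>2" using \<beta>1 by (intro mult_right_mono) simp_all
    finally show ?thesis .
  qed
  interpret linearized_primal_dual "total_cost f" "grad (total_cost f)" "\<lambda>z. A *v z" "\<lambda>u. transpose A *v u"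
    "\<lambda>z. ?B *v z" l ?b ?q \<kappa> \<rho> \<beta> x lam
  proof (rule linearized_primal_dual.intro)
    show "GDERIV (total_cost f) z :> grad (total_cost f) z" for z by (rule GDERIV_grad[OF fdiff])
    show "norm (grad (total_cost f) u - grad (total_cost f) v) \<le> l * norm (u - v)" for u v by (rule lip)
    show "0 \<le> total_cost f z" for z by (rule nonneg)
    show "linear (\<lambda>z. A *v z)" "linear (\<lambda>u. transpose A *v u)" "linear (\<lambda>z. ?B *v z)"
      by (rule matrix_vector_mul_linear)+
    show "(A *v z) \<bullet> u = z \<bullet> (transpose A *v u)" for z u by (rule adj)
    show "(?B *v u) \<bullet> v = u \<bullet> (?B *v v)" for u v by (rule kron_symmetric_inner[OF mix.symmetric(1)])
    show "(norm (A *v z))\<^sup>2 \<le> z \<bullet> (?B *v z)" for z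
      unfolding Az using kron_inner_le[of "Wt - W" 1 "mat 1 - Wt" z] mix.difference_le_complement by simp
    show "z \<bullet> (?B *v z) \<le> ?b * (norm z)\<^sup>2" for z by (rule kron_inner_le_norm[OF inner_le_spectral_norm])
    show "\<rho> * (z \<bullet> (?B *v z)) \<le> \<beta> * (norm z)\<^sup>2" for z
    proof -
      have "z \<bullet> (?B *v z) \<le> \<beta> / \<rho> * (norm z)\<^sup>2"
        using scaled \<rho> by (intro kron_inner_le_norm) (simp add: field_simps)
      then show ?thesis using \<rho> by (simp add: field_simps)
    qed
    show "norm (?B *v z - transpose A *v (A *v z)) \<le> ?q * norm z" for z
      using norm_kron_le[of "mat 1 - Wt - (Wt - W)" z]
      by (simp only: AtA kron_diff matrix_vector_mult_diff_rdistrib)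
    show "(norm (A *v z))\<^sup>2 \<le> \<kappa> * (norm (transpose A *v (A *v z)))\<^sup>2" for z
      unfolding Az AtA \<kappa>_def by (rule kron_inner_le_norm_image[OF mix.difference_le_image[OF lam2]])
    show "\<beta> *\<^sub>R (x (Suc n) - x n)
        = - (grad (total_cost f) (x n) + transpose A *v lam n + \<rho> *\<^sub>R (?B *v x n))" for n
      by (rule tt_extra_primal_step[OF \<beta> diff A tt dual_it])
    show "lam (Suc n) = lam n + \<rho> *\<^sub>R (A *v x (Suc n))" for n using dual_it by (simp add: dual_iterates_def)
  qed (use \<kappa> l \<rho> \<beta> step in auto)

  have A0: "(\<lambda>n. (norm (A *v x n))\<^sup>2) \<longlonglongrightarrow> 0" by (rule summable_LIMSEQ_zero[OF summable_consensus])
  have w0: "increment \<longlonglongrightarrow> 0"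
    using tendsto_zero_of_norm_square_le[of increment 1, OF _ summable_LIMSEQ_zero[OF summable_increment]]
    by simp
  \<comment> \<open>A form dominated by \<open>\<parallel>A z\<parallel>\<^sup>2\<close> has an image of size at most a multiple of \<open>\<parallel>A z\<parallel>\<close>.\<close>
  have image_le: "(norm (kron M (mat 1) *v z))\<^sup>2 \<le> (spectral_norm M + 1) * (c * (norm (A *v z))\<^sup>2)"
    if sym: "transpose M = M" and pos: "\<And>v. 0 \<le> v \<bullet> (M *v v)"
      and le: "\<And>v. v \<bullet> (M *v v) \<le> c * (v \<bullet> ((Wt - W) *v v))"
    for M :: "real ^ 'n ^ 'n" and c and z :: "real ^ ('n \<times> 'p)"
  proof -
    have "(norm (kron M (mat 1) *v z))\<^sup>2 \<le> (spectral_norm M + 1) * (z \<bullet> (kron M (mat 1) *v z))"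
    proof (rule psd_norm_le[of UNIV])
      show "v \<bullet> (kron M (mat 1) *v v) \<le> (spectral_norm M + 1) * (norm v)\<^sup>2" for v :: "real ^ ('n \<times> 'p)"
        using inner_le_spectral_norm[of _ M]
        by (intro kron_inner_le_norm) (simp add: distrib_right add_increasing2)
      show "0 \<le> v \<bullet> (kron M (mat 1) *v v)" for v :: "real ^ ('n \<times> 'p)"
        unfolding inner_slices slice_kron by (intro sum_nonneg pos)
    qed (use kron_symmetric_inner[OF sym] spectral_norm_nonneg[of M] in auto)
    also have "\<dots> \<le> (spectral_norm M + 1) * (c * (norm (A *v z))\<^sup>2)"
      unfolding Az using spectral_norm_nonneg[of M] by (intro mult_left_mono kron_inner_le le) simp
    finally show ?thesis .
  qed

  have consensus: "(\<lambda>r. kron (mat 1 - W) (mat 1 :: real ^ 'p ^ 'p) *v x r) \<longlonglongrightarrow> 0"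
  proof (rule tendsto_zero_of_norm_square_le[OF _ A0])
    have pos: "0 \<le> v \<bullet> ((mat 1 - W) *v v)" for v
      using mix.laplacian_split[of v] mix.difference_psd[of v] mix.difference_le_complement[of v] by linarith
    show "(norm (kron (mat 1 - W) (mat 1) *v x n))\<^sup>2
        \<le> (spectral_norm (mat 1 - W) + 1) * ((1 + 2 * \<rho>) / \<rho>) * (norm (A *v x n))\<^sup>2" for n
      using image_le[OF mix.symmetric(4) pos mix.laplacian_le_difference] by (simp only: mult.assoc)
  qed

  let ?R = "kron (rowvector 1 :: real ^ 'n ^ 1) (mat 1 :: real ^ 'p ^ 'p)"
  have dual_balanced: "?R *v (transpose A *v lam n) = 0" for n
  proof (induction n)
    case 0
    have "lam 0 = \<rho> *\<^sub>R (A *v x 0)" using dual_it by (simp add: dual_iterates_def)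
    then show ?case
      by (simp only: matrix_vector_mult_scaleR AtA
          kron_ones_annihilates[OF mix.symmetric(2) mix.ones_kernel(2)] scaleR_zero_right)
  next
    case (Suc n)
    have "lam (Suc n) = lam n + \<rho> *\<^sub>R (A *v x (Suc n))" using dual_it by (simp add: dual_iterates_def)
    then show ?case
      by (simp only: Suc matrix_vector_right_distrib matrix_vector_mult_scaleR AtA
          kron_ones_annihilates[OF mix.symmetric(2) mix.ones_kernel(2)] scaleR_zero_right add_0)
  qed
  have grad_eq: "grad (total_cost f) (x n)
      = - \<beta> *\<^sub>R increment n - transpose A *v lam n - \<rho> *\<^sub>R (?B *v x n)" for n
    using primal[of n] unfolding increment_def by (simp only: scaleR_minus_left) (simp add: algebra_simps del: transpose_matrix_vector)
  have "?R *v grad (total_cost f) (x n) = (- \<beta>) *\<^sub>R (?R *v increment n)" for n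
    unfolding grad_eq matrix_vector_mult_diff_distrib matrix_vector_mult_scaleR dual_balanced
      kron_ones_annihilates[OF mix.symmetric(1) mix.ones_kernel(1)] by simp
  moreover have "(\<lambda>n. (- \<beta>) *\<^sub>R (?R *v increment n)) \<longlonglongrightarrow> (- \<beta>) *\<^sub>R 0"
    by (intro tendsto_scaleR tendsto_const bounded_linear.tendsto_zero[OF matrix_vector_mul_bounded_linear w0])
  ultimately have stationary: "(\<lambda>r. ?R *v grad (total_cost f) (x r)) \<longlonglongrightarrow> 0" by simp

  define gap where "gap r = optimality_gap f Wt A (x r) (lam r)" for r
  define C where "C = 2 * (1 - \<rho>)\<^sup>2 * ((?b + 1) * ((1 + \<rho>) / \<rho>)) + 1"
  have pos: "0 \<le> v \<bullet> ((mat 1 - Wt) *v v)" for v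
    using mix.difference_psd[of v] mix.difference_le_complement[of v] by linarith
  have gap_le: "gap n \<le> 2 * \<beta>\<^sup>2 * (norm (increment n))\<^sup>2 + C * (norm (A *v x n))\<^sup>2" for n
  proof -
    \<comment> \<open>The gap carries the factor 1 where the primal step carries \<open>\<rho>\<close>; the discrepancy is a consensus
       term.\<close>
    have "grad (total_cost f) (x n) + transpose A *v lam n + ?B *v x n
        = (- \<beta>) *\<^sub>R increment n + (1 - \<rho>) *\<^sub>R (?B *v x n)"
      unfolding grad_eq by (simp add: scaleR_left_diff_distrib del: transpose_matrix_vector)
    then have "(norm (grad (total_cost f) (x n) + transpose A *v lam n + ?B *v x n))\<^sup>2
        \<le> 2 * (norm ((- \<beta>) *\<^sub>R increment n))\<^sup>2 + 2 * (norm ((1 - \<rho>) *\<^sub>R (?B *v x n)))\<^sup>2"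
      by (simp only: norm_add_square_le)
    also have "\<dots> = 2 * \<beta>\<^sup>2 * (norm (increment n))\<^sup>2 + 2 * (1 - \<rho>)\<^sup>2 * (norm (?B *v x n))\<^sup>2"
      by (simp add: power_mult_distrib)
    also have "2 * (1 - \<rho>)\<^sup>2 * (norm (?B *v x n))\<^sup>2
        \<le> 2 * (1 - \<rho>)\<^sup>2 * ((?b + 1) * ((1 + \<rho>) / \<rho> * (norm (A *v x n))\<^sup>2))"
      by (intro mult_left_mono image_le[OF mix.symmetric(1) pos mix.complement_le_difference]) simp
    also have "\<dots> = (C - 1) * (norm (A *v x n))\<^sup>2" by (simp add: C_def)
    finally show ?thesis by (simp add: gap_def optimality_gap_def left_diff_distrib del: transpose_matrix_vector)
  qed
  have gap_nonneg: "0 \<le> gap n" for n by (simp add: gap_def optimality_gap_def)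
  have "summable gap"
  proof (rule summable_comparison_test')
    show "summable (\<lambda>n. 2 * \<beta>\<^sup>2 * (norm (increment n))\<^sup>2 + C * (norm (A *v x n))\<^sup>2)"
      by (intro summable_add summable_mult summable_increment summable_consensus)
    show "norm (gap n) \<le> 2 * \<beta>\<^sup>2 * (norm (increment n))\<^sup>2 + C * (norm (A *v x n))\<^sup>2" for n
      using gap_le gap_nonneg by simp
  qed
  note rate = summable_imp_hitting_time_rate[OF this gap_nonneg]
  show ?thesis using consensus stationary rate unfolding gap_def by blast
qed

end
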